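(* For $f\in\mathcal{A}_c(\mathbb{R})$ let $\Omega_f(s)=\int_{-\infty}^\infty v_s f$ ($s\in\mathbb{R}$). (a) Let $\mathcal{C}_c(\mathbb{R})=\{\Omega_f\mid f\in\mathcal{A}_c(\mathbb{R})\}$ with norm $\|\Omega_f\|^{(1)}=\|f\|$. Then $\mathcal{C}_c(\mathbb{R})$ is a Banach space isometrically isomorphic to $\mathcal{A}_c(\mathbb{R})$. (b) Let $\mathcal{D}_c(\mathbb{R})=\{\Omega_f''\mid f\in\mathcal{A}_c(\mathbb{R})\}$ (second distributional derivatives) with norm $\|\Omega_f''\|^{(2)}=\|f\|$. Then $\mathcal{D}_c(\mathbb{R})$ is a Banach space isometrically isomorphic to $\mathcal{A}_c(\mathbb{R})$. (c) The four Banach spaces $\mathcal{A}_c(\mathbb{R})$ (with the Alexiewicz norm), $\mathcal{B}_c(\mathbb{R})$ (with the uniform norm), $\mathcal{C}_c(\mathbb{R})$ and $\mathcal{D}_c(\mathbb{R})$ are isometrically isomorphic.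
   Context: A function $F:[-\infty,\infty]\to\mathbb{C}$ is continuous on the extended real line if it is continuous on $\mathbb{R}$ and the limits $F(\pm\infty)$ exist. $\mathcal{B}_c(\mathbb{R})$ is the set of such $F$ with $F(-\infty)=0$, normed by $\|F\|_\infty=\sup|F|$. $\mathcal{A}_c(\mathbb{R})$ is the set of tempered distributions $f=F'$ (distributional derivative) with $F\in\mathcal{B}_c(\mathbb{R})$ (the primitive, unique); the Alexiewicz norm is $\|f\|=\|F\|_\infty$. For $g$ of bounded variation on $\mathbb{R}$, $\int_{-\infty}^\infty fg=F(\infty)g(\infty)-\int_{-\infty}^\infty F\,dg$. For $s,t\in\mathbb{R}$, $v_s(t)=(1-ist-e^{-ist})/t^2$ ($t\ne0$), $v_s(0)=s^2/2$; $v_s$ is of bounded variation in $t$. *)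

theory Defs
  imports "HOL-Analysis.Analysis"
begin

definition ext_cont :: "(real \<Rightarrow> complex) \<Rightarrow> bool" where
  "ext_cont F \<longleftrightarrow> continuous_on UNIV F \<and>
     (\<exists>L. (F \<longlongrightarrow> L) at_top) \<and> (\<exists>L. (F \<longlongrightarrow> L) at_bot)"

definition Bc :: "(real \<Rightarrow> complex) set" where
  "Bc = {F. ext_cont F \<and> (F \<longlongrightarrow> 0) at_bot}"

definition supnorm :: "(real \<Rightarrow> complex) \<Rightarrow> real" where
  "supnorm F = (SUP x. cmod (F x))"

definition smooth_fn :: "(real \<Rightarrow> real) \<Rightarrow> bool" where
  "smooth_fn \<phi> \<longleftrightarrow> (\<forall>k x. ((deriv ^^ k) \<phi>) differentiable (at x))"

definition test_fn :: "(real \<Rightarrow> real) \<Rightarrow> bool" where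
  "test_fn \<phi> \<longleftrightarrow> smooth_fn \<phi> \<and> bounded {x. \<phi> x \<noteq> 0}"

type_synonym distr = "(real \<Rightarrow> real) \<Rightarrow> complex"

text \<open>A distribution is identified with its restriction to test functions.\<close>
definition distr_of :: "distr \<Rightarrow> distr" where
  "distr_of T = (\<lambda>\<phi>. if test_fn \<phi> then T \<phi> else 0)"

definition dist_fun :: "(real \<Rightarrow> complex) \<Rightarrow> distr" where
  "dist_fun G = (\<lambda>\<phi>. integral UNIV (\<lambda>x. complex_of_real (\<phi> x) * G x))"

definition dderiv :: "distr \<Rightarrow> distr" where
  "dderiv T = (\<lambda>\<phi>. - T (deriv \<phi>))"

definition Ac :: "distr set" where
  "Ac = {distr_of (dderiv (dist_fun F)) | F. F \<in> Bc}"

definition prim :: "distr \<Rightarrow> (real \<Rightarrow> complex)" where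
  "prim f = (THE F. F \<in> Bc \<and> f = distr_of (dderiv (dist_fun F)))"

definition alex :: "distr \<Rightarrow> real" where
  "alex f = supnorm (prim f)"

text \<open>Pairing with a function g of bounded variation; for the (smooth) g used here
  the Stieltjes integral against dg is the integral against g'.\<close>
definition pairing :: "distr \<Rightarrow> (real \<Rightarrow> complex) \<Rightarrow> complex" where
  "pairing f g = Lim at_top (prim f) * Lim at_top g
     - integral UNIV (\<lambda>t. prim f t * vector_derivative g (at t))"

definition vfun :: "real \<Rightarrow> real \<Rightarrow> complex" where
  "vfun s t = (if t = 0 then complex_of_real (s\<^sup>2 / 2)
     else (1 - \<i> * complex_of_real (s * t) - exp (- \<i> * complex_of_real (s * t)))
           / complex_of_real (t\<^sup>2))"

definition Omega :: "distr \<Rightarrow> real \<Rightarrow> complex" where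
  "Omega f = (\<lambda>s. pairing f (vfun s))"

definition Omega2 :: "distr \<Rightarrow> distr" where
  "Omega2 f = distr_of (dderiv (dderiv (dist_fun (Omega f))))"

definition Cc :: "(real \<Rightarrow> complex) set" where
  "Cc = Omega ` Ac"

definition norm1 :: "(real \<Rightarrow> complex) \<Rightarrow> real" where
  "norm1 g = alex (THE f. f \<in> Ac \<and> Omega f = g)"

definition Dc :: "distr set" where
  "Dc = Omega2 ` Ac"

definition norm2 :: "distr \<Rightarrow> real" where
  "norm2 g = alex (THE f. f \<in> Ac \<and> Omega2 f = g)"

definition cspace :: "('a \<Rightarrow> complex) set \<Rightarrow> bool" where
  "cspace S \<longleftrightarrow> (\<lambda>x. 0) \<in> S \<and>
     (\<forall>f\<in>S. \<forall>g\<in>S. (\<lambda>x. f x + g x) \<in> S) \<and>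
     (\<forall>c. \<forall>f\<in>S. (\<lambda>x. c * f x) \<in> S)"

definition normed_on :: "('a \<Rightarrow> complex) set \<Rightarrow> (('a \<Rightarrow> complex) \<Rightarrow> real) \<Rightarrow> bool" where
  "normed_on S N \<longleftrightarrow>
     (\<forall>f\<in>S. 0 \<le> N f \<and> (N f = 0 \<longleftrightarrow> f = (\<lambda>x. 0))) \<and>
     (\<forall>c. \<forall>f\<in>S. N (\<lambda>x. c * f x) = cmod c * N f) \<and>
     (\<forall>f\<in>S. \<forall>g\<in>S. N (\<lambda>x. f x + g x) \<le> N f + N g)"

definition complete_on :: "('a \<Rightarrow> complex) set \<Rightarrow> (('a \<Rightarrow> complex) \<Rightarrow> real) \<Rightarrow> bool" where
  "complete_on S N \<longleftrightarrow>
     (\<forall>u. (\<forall>n. u n \<in> S) \<longrightarrow>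
        (\<forall>e>0. \<exists>M. \<forall>m\<ge>M. \<forall>n\<ge>M. N (\<lambda>x. u m x - u n x) < e) \<longrightarrow>
        (\<exists>l\<in>S. (\<lambda>n. N (\<lambda>x. u n x - l x)) \<longlonglongrightarrow> 0))"

definition banach_on :: "('a \<Rightarrow> complex) set \<Rightarrow> (('a \<Rightarrow> complex) \<Rightarrow> real) \<Rightarrow> bool" where
  "banach_on S N \<longleftrightarrow> cspace S \<and> normed_on S N \<and> complete_on S N"

definition isometric_iso ::
  "('a \<Rightarrow> complex) set \<Rightarrow> (('a \<Rightarrow> complex) \<Rightarrow> real) \<Rightarrow>
   ('b \<Rightarrow> complex) set \<Rightarrow> (('b \<Rightarrow> complex) \<Rightarrow> real) \<Rightarrow> bool" where
  "isometric_iso S N T M \<longleftrightarrow> (\<exists>\<Phi>. bij_betw \<Phi> S T \<and>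
     (\<forall>f\<in>S. \<forall>g\<in>S. \<Phi> (\<lambda>x. f x + g x) = (\<lambda>y. \<Phi> f y + \<Phi> g y)) \<and>
     (\<forall>c. \<forall>f\<in>S. \<Phi> (\<lambda>x. c * f x) = (\<lambda>y. c * \<Phi> f y)) \<and>
     (\<forall>f\<in>S. M (\<Phi> f) = N f))"

end

theory Submission
  imports Defs "HOL-Computational_Algebra.Polynomial" "HOL-Real_Asymp.Real_Asymp"
    "HOL-Probability.Sinc_Integral" "HOL-Probability.Characteristic_Functions"
begin

text \<open>
  All four spaces are images of \<open>Bc\<close> under injective linear maps that carry the uniform norm to the
  given norm, so everything reduces to completeness of \<open>Bc\<close> and to injectivity of \<open>F \<mapsto> F'\<close> and of
  \<open>F \<mapsto> \<Omega>''\<close>; the latter implies injectivity of \<open>F \<mapsto> \<Omega>\<close>.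

  Testing \<open>\<Omega>''\<close> against \<open>\<phi>\<close> and integrating by parts twice in \<open>s\<close>, where the second \<open>s\<close>-derivative of
  \<open>v\<^sub>s(t)\<close> is \<open>exp (- i s t)\<close>, gives minus the integral of \<open>F\<close> against the derivative of the Fourier
  transform of \<open>\<phi>\<close>. Hence the null spaces of \<open>F \<mapsto> F'\<close> and \<open>F \<mapsto> \<Omega>''\<close> consist of \<open>F\<close> orthogonal to
  the derivatives of all translates and dilates of an integrable \<open>C\<^sup>1\<close> function \<open>k\<close> with integrable
  derivative and nonzero integral: a bump function in the first case; in the second the transform of
  a bump function \<open>\<psi>\<close>, whose integral is \<open>2 \<pi> \<psi>(0)\<close> by Fourier inversion. The correlation of such
  an \<open>F\<close> with each dilate of \<open>k\<close> is constant, hence \<open>0\<close> because \<open>F(-\<infinity>) = 0\<close>, and shrinking the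
  dilates gives \<open>F = 0\<close>.
\<close>

section \<open>Isometric isomorphisms of function spaces\<close>

definition clinear_on :: "('a \<Rightarrow> complex) set \<Rightarrow> (('a \<Rightarrow> complex) \<Rightarrow> 'b \<Rightarrow> complex) \<Rightarrow> bool" where
  "clinear_on S \<Phi> \<longleftrightarrow>
     (\<forall>f\<in>S. \<forall>g\<in>S. \<Phi> (\<lambda>x. f x + g x) = (\<lambda>y. \<Phi> f y + \<Phi> g y)) \<and>
     (\<forall>c. \<forall>f\<in>S. \<Phi> (\<lambda>x. c * f x) = (\<lambda>y. c * \<Phi> f y))"

lemma clinear_on_add:
  "clinear_on S \<Phi> \<Longrightarrow> f \<in> S \<Longrightarrow> g \<in> S \<Longrightarrow> \<Phi> (\<lambda>x. f x + g x) = (\<lambda>y. \<Phi> f y + \<Phi> g y)"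
  by (simp add: clinear_on_def)

lemma clinear_on_scale: "clinear_on S \<Phi> \<Longrightarrow> f \<in> S \<Longrightarrow> \<Phi> (\<lambda>x. c * f x) = (\<lambda>y. c * \<Phi> f y)"
  by (simp add: clinear_on_def)

lemma cspace_0: "cspace S \<Longrightarrow> (\<lambda>x. 0) \<in> S"
  and cspace_add: "cspace S \<Longrightarrow> f \<in> S \<Longrightarrow> g \<in> S \<Longrightarrow> (\<lambda>x. f x + g x) \<in> S"
  and cspace_scale: "cspace S \<Longrightarrow> f \<in> S \<Longrightarrow> (\<lambda>x. c * f x) \<in> S"
  by (simp_all add: cspace_def)

lemma cspace_diff: "cspace S \<Longrightarrow> f \<in> S \<Longrightarrow> g \<in> S \<Longrightarrow> (\<lambda>x. f x - g x) \<in> S"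
  using cspace_add[OF _ _ cspace_scale, of S f g "- 1"] by simp

lemma clinear_on_0: "cspace S \<Longrightarrow> clinear_on S \<Phi> \<Longrightarrow> \<Phi> (\<lambda>x. 0) = (\<lambda>y. 0)"
  using clinear_on_scale[OF _ cspace_0, of S \<Phi> 0] by simp

lemma clinear_on_diff:
  assumes "cspace S" "clinear_on S \<Phi>" "f \<in> S" "g \<in> S"
  shows "\<Phi> (\<lambda>x. f x - g x) = (\<lambda>y. \<Phi> f y - \<Phi> g y)"
  using clinear_on_add[OF assms(2,3) cspace_scale[OF assms(1,4), of "- 1"]]
    clinear_on_scale[OF assms(2,4), of "- 1"] by simp

lemma inj_on_clinear_iff:
  assumes S: "cspace S" and \<Phi>: "clinear_on S \<Phi>"
  shows "inj_on \<Phi> S \<longleftrightarrow> (\<forall>f\<in>S. \<Phi> f = (\<lambda>y. 0) \<longrightarrow> f = (\<lambda>x. 0))"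
proof
  assume "inj_on \<Phi> S"
  then show "\<forall>f\<in>S. \<Phi> f = (\<lambda>y. 0) \<longrightarrow> f = (\<lambda>x. 0)"
    using clinear_on_0[OF S \<Phi>] cspace_0[OF S] by (metis inj_onD)
next
  assume kernel: "\<forall>f\<in>S. \<Phi> f = (\<lambda>y. 0) \<longrightarrow> f = (\<lambda>x. 0)"
  show "inj_on \<Phi> S"
  proof (rule inj_onI)
    fix f g assume fg: "f \<in> S" "g \<in> S" "\<Phi> f = \<Phi> g"
    then have "\<Phi> (\<lambda>x. f x - g x) = (\<lambda>y. 0)"
      by (simp add: clinear_on_diff[OF S \<Phi>])
    then have "(\<lambda>x. f x - g x) = (\<lambda>x. 0)"
      using kernel cspace_diff[OF S fg(1,2)] by blast
    then show "f = g" by (simp add: fun_eq_iff)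
  qed
qed

lemma isometric_iso_iff:
  "isometric_iso S N T M \<longleftrightarrow> (\<exists>\<Phi>. bij_betw \<Phi> S T \<and> clinear_on S \<Phi> \<and> (\<forall>f\<in>S. M (\<Phi> f) = N f))"
  by (simp add: isometric_iso_def clinear_on_def conj_assoc)

lemma isometric_iso_image:
  assumes "clinear_on S \<Phi>" "inj_on \<Phi> S" "\<And>f. f \<in> S \<Longrightarrow> M (\<Phi> f) = N f"
  shows "isometric_iso S N (\<Phi> ` S) M"
  unfolding isometric_iso_iff
  using assms by (intro exI[of _ \<Phi>]) (simp add: inj_on_imp_bij_betw)

lemma clinear_on_inv_into:
  assumes S: "cspace S" and \<Phi>: "clinear_on S \<Phi>" and bij: "bij_betw \<Phi> S T"
  shows "clinear_on T (inv_into S \<Phi>)"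
proof -
  let ?\<Psi> = "inv_into S \<Phi>"
  have \<Psi>: "?\<Psi> u \<in> S" "\<Phi> (?\<Psi> u) = u" if "u \<in> T" for u
    using that bij by (auto simp: bij_betw_def inv_into_into f_inv_into_f)
  have \<Psi>_eqI: "?\<Psi> u = f" if "f \<in> S" "\<Phi> f = u" for f u
    using bij_betw_inv_into_left[OF bij] that by blast
  show ?thesis
    unfolding clinear_on_def
    by (intro conjI ballI allI \<Psi>_eqI cspace_add[OF S] cspace_scale[OF S])
      (simp_all add: \<Psi> clinear_on_add[OF \<Phi>] clinear_on_scale[OF \<Phi>])
qed

lemma isometric_iso_sym:
  assumes S: "cspace S" and iso: "isometric_iso S N T M"
  shows "isometric_iso T M S N"
proof -
  obtain \<Phi> where \<Phi>: "bij_betw \<Phi> S T" "clinear_on S \<Phi>" "\<And>f. f \<in> S \<Longrightarrow> M (\<Phi> f) = N f"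
    using iso unfolding isometric_iso_iff by blast
  have "N (inv_into S \<Phi> u) = M u" if "u \<in> T" for u
    using \<Phi> that by (metis bij_betw_imp_surj_on f_inv_into_f inv_into_into)
  with \<Phi> show ?thesis
    unfolding isometric_iso_iff by (blast intro: bij_betw_inv_into clinear_on_inv_into[OF S])
qed

lemma isometric_iso_trans:
  assumes "isometric_iso S N T M" and "isometric_iso T M U K"
  shows "isometric_iso S N U K"
proof -
  obtain \<Phi> where \<Phi>: "bij_betw \<Phi> S T" "clinear_on S \<Phi>" "\<forall>f\<in>S. M (\<Phi> f) = N f"
    using assms(1) unfolding isometric_iso_iff by blast
  obtain \<Psi> where \<Psi>: "bij_betw \<Psi> T U" "clinear_on T \<Psi>" "\<forall>g\<in>T. K (\<Psi> g) = M g"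
    using assms(2) unfolding isometric_iso_iff by blast
  have "\<Phi> f \<in> T" if "f \<in> S" for f using \<Phi>(1) that by (rule bij_betwE[rule_format])
  then have "clinear_on S (\<Psi> \<circ> \<Phi>)" "\<forall>f\<in>S. K ((\<Psi> \<circ> \<Phi>) f) = N f"
    using \<Phi> \<Psi> by (auto simp: clinear_on_def)
  with bij_betw_trans[OF \<Phi>(1) \<Psi>(1)] show ?thesis
    unfolding isometric_iso_iff by blast
qed

lemma cspace_clinear_image:
  assumes S: "cspace S" and \<Phi>: "clinear_on S \<Phi>"
  shows "cspace (\<Phi> ` S)"
  unfolding cspace_def
proof (intro conjI ballI allI)
  show "(\<lambda>y. 0) \<in> \<Phi> ` S" using clinear_on_0[OF S \<Phi>] cspace_0[OF S] by (metis imageI)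
  show "(\<lambda>y. u y + v y) \<in> \<Phi> ` S" if "u \<in> \<Phi> ` S" "v \<in> \<Phi> ` S" for u v
    using that by (auto simp flip: clinear_on_add[OF \<Phi>] intro!: imageI cspace_add[OF S])
  show "(\<lambda>y. c * u y) \<in> \<Phi> ` S" if "u \<in> \<Phi> ` S" for u c
    using that by (auto simp flip: clinear_on_scale[OF \<Phi>] intro!: imageI cspace_scale[OF S])
qed

lemma normed_on_pullback:
  assumes S: "normed_on S N" and T: "cspace T" and \<Phi>: "clinear_on T \<Phi>" "bij_betw \<Phi> T S"
    and norm: "\<And>f. f \<in> T \<Longrightarrow> N (\<Phi> f) = M f"
  shows "normed_on T M"
  unfolding normed_on_def
proof (intro conjI ballI allI)
  have \<Phi>_in: "\<Phi> f \<in> S" if "f \<in> T" for f using \<Phi>(2) that by (rule bij_betwE[rule_format])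
  fix f assume f: "f \<in> T"
  show "0 \<le> M f" using S \<Phi>_in[OF f] by (simp add: normed_on_def flip: norm[OF f])
  have "\<Phi> f = (\<lambda>x. 0) \<longleftrightarrow> f = (\<lambda>x. 0)"
    using \<Phi> f T by (metis bij_betw_imp_inj_on clinear_on_0 inj_on_clinear_iff)
  then show "M f = 0 \<longleftrightarrow> f = (\<lambda>x. 0)"
    using S \<Phi>_in[OF f] by (simp add: normed_on_def flip: norm[OF f])
  show "M (\<lambda>x. c * f x) = cmod c * M f" for c
    using S \<Phi>_in[OF f]
    by (simp add: normed_on_def f clinear_on_scale[OF \<Phi>(1)] cspace_scale[OF T] flip: norm)
  show "M (\<lambda>x. f x + g x) \<le> M f + M g" if g: "g \<in> T" for g
    using S \<Phi>_in[OF f] \<Phi>_in[OF g]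
    by (simp add: normed_on_def f g clinear_on_add[OF \<Phi>(1)] cspace_add[OF T] flip: norm)
qed

lemma complete_on_pullback:
  assumes S: "complete_on S N" and T: "cspace T" and \<Phi>: "clinear_on T \<Phi>" "bij_betw \<Phi> T S"
    and norm: "\<And>f. f \<in> T \<Longrightarrow> N (\<Phi> f) = M f"
  shows "complete_on T M"
  unfolding complete_on_def
proof (intro allI impI)
  fix u :: "nat \<Rightarrow> _"
  assume u: "\<forall>n. u n \<in> T" and Cauchy: "\<forall>e>0. \<exists>K. \<forall>m\<ge>K. \<forall>n\<ge>K. M (\<lambda>x. u m x - u n x) < e"
  have M_diff: "M (\<lambda>x. f x - g x) = N (\<lambda>y. \<Phi> f y - \<Phi> g y)" if "f \<in> T" "g \<in> T" for f g
    using norm[OF cspace_diff[OF T that]] by (simp add: clinear_on_diff[OF T \<Phi>(1) that])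
  have "\<forall>n. \<Phi> (u n) \<in> S" using u \<Phi>(2) by (auto simp: bij_betw_def)
  moreover have "\<forall>e>0. \<exists>K. \<forall>m\<ge>K. \<forall>n\<ge>K. N (\<lambda>y. \<Phi> (u m) y - \<Phi> (u n) y) < e"
    using Cauchy u by (simp add: M_diff)
  ultimately obtain l where "l \<in> S" and l: "(\<lambda>n. N (\<lambda>y. \<Phi> (u n) y - l y)) \<longlonglongrightarrow> 0"
    using S[unfolded complete_on_def, rule_format, of "\<lambda>n. \<Phi> (u n)"] by blast
  then obtain f where f: "f \<in> T" "l = \<Phi> f" using \<Phi>(2) \<open>l \<in> S\<close> by (auto simp: bij_betw_def)
  with l u have "(\<lambda>n. M (\<lambda>x. u n x - f x)) \<longlonglongrightarrow> 0" by (simp add: M_diff)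
  with f(1) show "\<exists>f\<in>T. (\<lambda>n. M (\<lambda>x. u n x - f x)) \<longlonglongrightarrow> 0" by blast
qed

lemma banach_on_isometric_iso:
  assumes S: "banach_on S N" and iso: "isometric_iso S N T M"
  shows "banach_on T M"
proof -
  have "cspace S" using S by (simp add: banach_on_def)
  have "cspace T"
    using iso cspace_clinear_image[OF \<open>cspace S\<close>] unfolding isometric_iso_iff
    by (metis bij_betw_imp_surj_on)
  moreover obtain \<Phi> where "bij_betw \<Phi> T S" "clinear_on T \<Phi>" "\<And>f. f \<in> T \<Longrightarrow> N (\<Phi> f) = M f"
    using isometric_iso_sym[OF \<open>cspace S\<close> iso] unfolding isometric_iso_iff by blast
  ultimately show ?thesis
    using S normed_on_pullback complete_on_pullback unfolding banach_on_def by metis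
qed

section \<open>The Banach space of primitives\<close>

lemma bounded_range_if_limits:
  fixes F :: "real \<Rightarrow> 'a::metric_space"
  assumes "continuous_on UNIV F" "(F \<longlongrightarrow> L) at_top" "(F \<longlongrightarrow> L') at_bot"
  shows "bounded (range F)"
proof -
  obtain a where a: "\<And>x. x \<ge> a \<Longrightarrow> dist (F x) L < 1"
    using tendstoD[OF assms(2), of 1] by (auto simp: eventually_at_top_linorder)
  obtain b where b: "\<And>x. x \<le> b \<Longrightarrow> dist (F x) L' < 1"
    using tendstoD[OF assms(3), of 1] by (auto simp: eventually_at_bot_linorder)
  have "bounded (F ` {b..a})"
    by (intro compact_imp_bounded compact_continuous_image continuous_on_subset[OF assms(1)]) auto
  then have "bounded (F ` {b..a} \<union> ball L 1 \<union> ball L' 1)" by simp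
  moreover have "F x \<in> F ` {b..a} \<union> ball L 1 \<union> ball L' 1" for x
    using a[of x] b[of x] by (cases "x \<ge> a"; cases "x \<le> b") (auto simp: dist_commute)
  ultimately show ?thesis by (metis bounded_subset image_subsetI)
qed

lemma Bc_iff: "F \<in> Bc \<longleftrightarrow> continuous_on UNIV F \<and> (\<exists>L. (F \<longlongrightarrow> L) at_top) \<and> (F \<longlongrightarrow> 0) at_bot"
  by (auto simp: Bc_def ext_cont_def)

lemma Bc_continuous: "F \<in> Bc \<Longrightarrow> continuous_on UNIV F"
  and Bc_tendsto_at_bot: "F \<in> Bc \<Longrightarrow> (F \<longlongrightarrow> 0) at_bot"
  by (auto simp: Bc_iff)

lemma Bc_bounded: "F \<in> Bc \<Longrightarrow> bounded (range F)"
  using bounded_range_if_limits by (auto simp: Bc_iff)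

lemma cmod_le_supnorm:
  assumes "bounded (range F)" shows "cmod (F x) \<le> supnorm F"
  unfolding supnorm_def
proof (rule cSUP_upper)
  show "bdd_above (range (\<lambda>x. cmod (F x)))"
    using assms by (auto simp: bounded_iff bdd_above_def)
qed simp

lemma supnorm_le: "(\<And>x. cmod (F x) \<le> B) \<Longrightarrow> supnorm F \<le> B"
  unfolding supnorm_def by (rule cSUP_least) auto

lemma supnorm_nonneg: "bounded (range F) \<Longrightarrow> 0 \<le> supnorm F"
  using order_trans[OF norm_ge_zero cmod_le_supnorm] .

lemma supnorm_scale:
  assumes F: "bounded (range F)" shows "supnorm (\<lambda>x. c * F x) = cmod c * supnorm F"
proof (cases "c = 0")
  case True
  then show ?thesis by (simp add: supnorm_def)
next
  case False
  have upper: "supnorm (\<lambda>x. d * G x) \<le> cmod d * supnorm G" if "bounded (range G)" for d G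
    by (rule supnorm_le) (simp add: norm_mult mult_left_mono cmod_le_supnorm[OF that])
  have "bounded (range (\<lambda>x. c * F x))"
    using bounded_linear_image[OF F bounded_linear_mult_right[of c]] by (simp add: image_image)
  from upper[OF this, of "inverse c"] have "cmod c * supnorm F \<le> supnorm (\<lambda>x. c * F x)"
    using False by (simp add: norm_divide field_simps)
  with upper[OF F] show ?thesis by (rule antisym)
qed

lemma cspace_Bc: "cspace Bc"
  unfolding cspace_def
proof (intro conjI ballI allI)
  show "(\<lambda>x. 0) \<in> Bc" by (auto simp: Bc_iff)
  show "(\<lambda>x. f x + g x) \<in> Bc" if "f \<in> Bc" "g \<in> Bc" for f g
    using that tendsto_add[of f 0 at_bot g 0]
    by (auto simp: Bc_iff intro: continuous_on_add tendsto_add)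
  show "(\<lambda>x. c * f x) \<in> Bc" if "f \<in> Bc" for f c
    using that tendsto_mult_left[of f 0 at_bot c]
    by (auto simp: Bc_iff intro: continuous_on_mult_left tendsto_mult_left)
qed

lemma normed_on_Bc: "normed_on Bc supnorm"
  unfolding normed_on_def
proof (intro conjI ballI allI)
  fix F assume "F \<in> Bc"
  then have F: "bounded (range F)" by (rule Bc_bounded)
  show "0 \<le> supnorm F" by (rule supnorm_nonneg[OF F])
  show "supnorm F = 0 \<longleftrightarrow> F = (\<lambda>x. 0)"
    using cmod_le_supnorm[OF F] by (auto simp: supnorm_def)
  show "supnorm (\<lambda>x. c * F x) = cmod c * supnorm F" for c by (rule supnorm_scale[OF F])
  show "supnorm (\<lambda>x. F x + G x) \<le> supnorm F + supnorm G" if "G \<in> Bc" for G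
    by (intro supnorm_le norm_triangle_le add_mono cmod_le_supnorm F Bc_bounded[OF that])
qed

lemma uniform_limit_tendsto_exists:
  fixes u :: "'n \<Rightarrow> 'a \<Rightarrow> 'b::complete_space"
  assumes lim: "uniform_limit UNIV u l F" "F \<noteq> bot"
    and u: "\<And>n. \<exists>L. (u n \<longlongrightarrow> L) A" and A: "A \<noteq> bot"
  shows "\<exists>L. (l \<longlongrightarrow> L) A"
proof -
  have "cauchy_filter (filtermap l A)"
    unfolding cauchy_filter_metric_filtermap
  proof (intro allI impI)
    fix e :: real assume e: "e > 0"
    then obtain n where n: "\<And>x. dist (u n x) (l x) < e / 4"
      using eventually_happens[OF uniform_limitD[OF lim(1), of "e / 4"]] lim(2) by auto
    obtain L where L: "(u n \<longlongrightarrow> L) A" using u by blast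
    have "dist (l x) (l y) < e" if "dist (u n x) L < e / 4" "dist (u n y) L < e / 4" for x y
      using that n[of x] n[of y] by metric
    with tendstoD[OF L, of "e / 4"] e
    show "\<exists>P. eventually P A \<and> (\<forall>x y. P x \<and> P y \<longrightarrow> dist (l x) (l y) < e)"
      by (intro exI[of _ "\<lambda>x. dist (u n x) L < e / 4"]) auto
  qed
  then show ?thesis
    using cauchy_filter_complete_converges[of "filtermap l A" UNIV] A
    by (simp add: filterlim_def filtermap_bot_iff complete_UNIV)
qed

lemma Bc_uniform_limit:
  assumes u: "\<And>n. u n \<in> Bc" and lim: "uniform_limit UNIV u l sequentially"
  shows "l \<in> Bc"
proof -
  have "\<exists>L. (l \<longlongrightarrow> L) at_top"
    by (rule uniform_limit_tendsto_exists[OF lim]) (use u in \<open>auto simp: Bc_iff\<close>)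
  moreover have "(l \<longlongrightarrow> 0) at_bot"
    using swap_uniform_limit'[of u "\<lambda>_. 0" at_bot sequentially 0 UNIV l] u lim
    by (auto simp: Bc_iff)
  moreover have "continuous_on UNIV l"
    by (rule uniform_limit_theorem[OF _ lim]) (use u in \<open>auto simp: Bc_iff\<close>)
  ultimately show ?thesis by (simp add: Bc_iff)
qed

lemma complete_on_Bc: "complete_on Bc supnorm"
  unfolding complete_on_def
proof (intro allI impI)
  fix u :: "nat \<Rightarrow> real \<Rightarrow> complex"
  assume u: "\<forall>n. u n \<in> Bc"
    and Cauchy: "\<forall>e>0. \<exists>K. \<forall>m\<ge>K. \<forall>n\<ge>K. supnorm (\<lambda>x. u m x - u n x) < e"
  have bounded: "bounded (range (\<lambda>x. u n x - f x))" if "f \<in> Bc" for n f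
    using u that by (intro Bc_bounded cspace_diff[OF cspace_Bc]) auto
  have "uniformly_Cauchy_on UNIV u"
  proof (rule uniformly_Cauchy_onI)
    fix e :: real assume "e > 0"
    with Cauchy obtain K where "supnorm (\<lambda>x. u m x - u n x) < e" if "m \<ge> K" "n \<ge> K" for m n by meson
    then show "\<exists>K. \<forall>x\<in>UNIV. \<forall>m\<ge>K. \<forall>n\<ge>K. dist (u m x) (u n x) < e"
      using cmod_le_supnorm[OF bounded] u unfolding dist_norm by (meson le_less_trans)
  qed
  then obtain l where l: "uniform_limit UNIV u l sequentially"
    using Cauchy_uniformly_convergent uniformly_convergent_on_def by metis
  then have "l \<in> Bc" using u by (blast intro: Bc_uniform_limit)
  moreover have "(\<lambda>n. supnorm (\<lambda>x. u n x - l x)) \<longlonglongrightarrow> 0"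
  proof (rule tendstoI)
    fix e :: real assume e: "e > 0"
    then have "\<forall>\<^sub>F n in sequentially. \<forall>x. dist (u n x) (l x) < e / 2"
      using uniform_limitD[OF l, of "e / 2"] by simp
    then show "\<forall>\<^sub>F n in sequentially. dist (supnorm (\<lambda>x. u n x - l x)) 0 < e"
    proof eventually_elim
      case (elim n)
      then have "supnorm (\<lambda>x. u n x - l x) \<le> e / 2"
        by (intro supnorm_le) (simp add: dist_norm less_imp_le)
      with supnorm_nonneg[OF bounded[OF \<open>l \<in> Bc\<close>]] e show ?case by simp
    qed
  qed
  ultimately show "\<exists>l\<in>Bc. (\<lambda>n. supnorm (\<lambda>x. u n x - l x)) \<longlonglongrightarrow> 0" by blast
qed

lemma banach_on_Bc: "banach_on Bc supnorm"
  by (simp add: banach_on_def cspace_Bc normed_on_Bc complete_on_Bc)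

section \<open>Test functions\<close>

lemma smooth_fn_family:
  assumes f: "\<And>i x. (f i has_real_derivative f (d i) x) (at x)" shows "smooth_fn (f i)"
proof -
  have "deriv (f i) = f (d i)" for i using DERIV_imp_deriv[OF f] by (rule ext)
  then have "(deriv ^^ k) (f i) = f ((d ^^ k) i)" for k by (induction k) simp_all
  with f show ?thesis by (auto simp: smooth_fn_def real_differentiable_def)
qed

lemma smooth_fn_has_derivative_funpow:
  "smooth_fn f \<Longrightarrow> ((deriv ^^ k) f has_real_derivative (deriv ^^ Suc k) f x) (at x)"
  unfolding smooth_fn_def using DERIV_imp_deriv by (fastforce simp: real_differentiable_def)

lemma smooth_fn_has_derivative: "smooth_fn f \<Longrightarrow> (f has_real_derivative deriv f x) (at x)"
  using smooth_fn_has_derivative_funpow[of f 0] by simp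

lemma smooth_fn_deriv: "smooth_fn f \<Longrightarrow> smooth_fn (deriv f)"
  unfolding smooth_fn_def by (metis funpow_Suc_right comp_apply)

lemma smooth_fn_continuous:
  assumes "smooth_fn f" shows "continuous_on S f"
  by (rule DERIV_continuous_on)
    (rule has_field_derivative_at_within[OF smooth_fn_has_derivative[OF assms]])

lemma smooth_fn_mult:
  assumes f: "smooth_fn f" and g: "smooth_fn g" shows "smooth_fn (\<lambda>x. f x * g x)"
proof -
  define p where "p ijs x = (\<Sum>(i, j)\<leftarrow>ijs. (deriv ^^ i) f x * (deriv ^^ j) g x)" for ijs x
  define d where "d ijs = concat (map (\<lambda>(i, j). [(Suc i, j), (i, Suc j)]) ijs)"
    for ijs :: "(nat \<times> nat) list"
  have "(p ijs has_real_derivative p (d ijs) x) (at x)" for ijs x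
  proof (induction ijs)
    case Nil
    then show ?case by (simp add: p_def[abs_def] d_def)
  next
    case (Cons ij ijs)
    obtain i j where ij: "ij = (i, j)" by fastforce
    have "((\<lambda>x. (deriv ^^ i) f x * (deriv ^^ j) g x + p ijs x) has_real_derivative
        (deriv ^^ Suc i) f x * (deriv ^^ j) g x + (deriv ^^ Suc j) g x * (deriv ^^ i) f x
          + p (d ijs) x) (at x)"
      by (intro DERIV_add DERIV_mult smooth_fn_has_derivative_funpow f g Cons.IH)
    then show ?case by (simp add: p_def[abs_def] d_def ij mult.commute add.assoc)
  qed
  from smooth_fn_family[of p d "[(0, 0)]", OF this] show ?thesis by (simp add: p_def[abs_def])
qed

lemma has_real_derivative_comp_affine:
  assumes "(f has_real_derivative f') (at (a + b * x))"
  shows "((\<lambda>x. f (a + b * x)) has_real_derivative b * f') (at x)"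
proof -
  have "((\<lambda>x. a + b * x) has_real_derivative b) (at x)" by (auto intro!: derivative_eq_intros)
  from DERIV_chain2[OF assms this] show ?thesis by (simp add: mult.commute)
qed

lemma smooth_fn_comp_affine:
  assumes "smooth_fn f" shows "smooth_fn (\<lambda>x. f (a + b * x))"
proof -
  have "((\<lambda>x. b ^ k * (deriv ^^ k) f (a + b * x)) has_real_derivative
      b ^ Suc k * (deriv ^^ Suc k) f (a + b * x)) (at x)" for k x
    by (rule DERIV_cong[OF DERIV_cmult[OF has_real_derivative_comp_affine[OF
            smooth_fn_has_derivative_funpow[OF assms]]]]) (simp add: mult_ac)
  from smooth_fn_family[of "\<lambda>k x. b ^ k * (deriv ^^ k) f (a + b * x)" Suc 0, OF this]
  show ?thesis by simp
qed

lemma smooth_fn_linear: "smooth_fn (\<lambda>x. a * x + b)"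
proof -
  let ?f = "\<lambda>(a, b) x. a * x + b" and ?d = "\<lambda>(a, b). (0, a)"
  have "(?f i has_real_derivative ?f (?d i) x) (at x)" for i x
    by (cases i) (auto intro!: derivative_eq_intros)
  from smooth_fn_family[of ?f ?d "(a, b)", OF this] show ?thesis by simp
qed

lemma smooth_fn_cos_sin: "smooth_fn (\<lambda>x. c * cos (a * x) + d * sin (a * x))"
proof -
  let ?f = "\<lambda>(c, d) x. c * cos (a * x) + d * sin (a * x)" and ?d = "\<lambda>(c, d). (d * a, - c * a)"
  have "(?f i has_real_derivative ?f (?d i) x) (at x)" for i x
    by (cases i) (auto intro!: derivative_eq_intros)
  from smooth_fn_family[of ?f ?d "(c, d)", OF this] show ?thesis by simp
qed

lemma bounded_support_derivative:
  assumes f': "\<And>x. (f has_vector_derivative f' x) (at x)" and f: "bounded {x. f x \<noteq> 0}"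
  shows "bounded {x. f' x \<noteq> 0}"
proof (rule bounded_subset[OF bounded_closure[OF f]])
  have "f' x = 0" if "x \<notin> closure {x. f x \<noteq> 0}" for x
  proof -
    have "(f has_vector_derivative 0) (at x)"
      by (rule has_vector_derivative_transform_within_open[OF has_vector_derivative_const[of 0],
          where S = "- closure {x. f x \<noteq> 0}"])
        (use that closure_subset[of "{x. f x \<noteq> 0}"] in auto)
    with f' show ?thesis by (rule vector_derivative_unique_at)
  qed
  then show "{x. f' x \<noteq> 0} \<subseteq> closure {x. f x \<noteq> 0}" by blast
qed

lemma integrable_continuous_bounded_support:
  fixes f :: "'a::euclidean_space \<Rightarrow> 'b::{banach, second_countable_topology}"
  assumes "continuous_on UNIV f" "bounded {x. f x \<noteq> 0}"
  shows "integrable lborel f"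
proof -
  have "integrable lborel (\<lambda>x. indicator (closure {x. f x \<noteq> 0}) x *\<^sub>R f x)"
    using assms by (intro borel_integrable_compact) (auto intro: continuous_on_subset)
  also have "(\<lambda>x. indicator (closure {x. f x \<noteq> 0}) x *\<^sub>R f x) = f"
    using closure_subset[of "{x. f x \<noteq> 0}"] by (auto simp: indicator_def fun_eq_iff)
  finally show ?thesis .
qed

lemma LINT_derivative_bounded_support:
  fixes f f' :: "real \<Rightarrow> 'a::euclidean_space"
  assumes f': "\<And>x. (f has_vector_derivative f' x) (at x)" and cont: "continuous_on UNIV f'"
    and f: "bounded {x. f x \<noteq> 0}"
  shows "(LINT x|lborel. f' x) = 0"
proof -
  have "bounded ({x. f x \<noteq> 0} \<union> {x. f' x \<noteq> 0})"
    using f bounded_support_derivative[OF f' f] by simp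
  then obtain r where "r > 0" and r: "{x. f x \<noteq> 0} \<union> {x. f' x \<noteq> 0} \<subseteq> ball 0 r"
    using bounded_subset_ballD by blast
  have "f' = (\<lambda>x. indicator {-r..r} x *\<^sub>R f' x)"
    using r by (auto simp: indicator_def fun_eq_iff subset_iff)
  then have "(LINT x|lborel. f' x) = (LINT x|lborel. indicator {-r..r} x *\<^sub>R f' x)" by simp
  also have "\<dots> = f r - f (- r)"
    using \<open>r > 0\<close> f' cont by (intro integral_FTC_atLeastAtMost)
      (auto intro: has_vector_derivative_at_within continuous_on_subset)
  also have "f r = 0" using r by auto
  also have "f (- r) = 0" using r by auto
  finally show ?thesis by simp
qed

lemma test_fn_has_derivative: "test_fn \<phi> \<Longrightarrow> (\<phi> has_real_derivative deriv \<phi> x) (at x)"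
  by (simp add: test_fn_def smooth_fn_has_derivative)

lemma test_fn_continuous: "test_fn \<phi> \<Longrightarrow> continuous_on S \<phi>"
  by (simp add: test_fn_def smooth_fn_continuous)

lemma test_fn_bounded:
  assumes "test_fn \<phi>" shows "bounded (range \<phi>)"
proof (rule bounded_subset)
  show "bounded (insert 0 (\<phi> ` closure {x. \<phi> x \<noteq> 0}))"
    using assms test_fn_continuous[OF assms]
    by (simp add: test_fn_def compact_closure compact_continuous_image compact_imp_bounded)
  show "range \<phi> \<subseteq> insert 0 (\<phi> ` closure {x. \<phi> x \<noteq> 0})"
    using closure_subset[of "{x. \<phi> x \<noteq> 0}"] by auto
qed

lemma test_fn_deriv: "test_fn \<phi> \<Longrightarrow> test_fn (deriv \<phi>)"
  using bounded_support_derivative[of \<phi> "deriv \<phi>"] smooth_fn_has_derivative[of \<phi>]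
  by (simp add: test_fn_def smooth_fn_deriv has_real_derivative_iff_has_vector_derivative)

lemma test_fn_mult: "smooth_fn f \<Longrightarrow> test_fn \<phi> \<Longrightarrow> test_fn (\<lambda>x. f x * \<phi> x)"
  by (auto simp: test_fn_def smooth_fn_mult intro: bounded_subset)

lemma test_fn_comp_affine:
  assumes \<phi>: "test_fn \<phi>" and "b \<noteq> 0" shows "test_fn (\<lambda>x. \<phi> (a + b * x))"
proof -
  have "{x. \<phi> (a + b * x) \<noteq> 0} \<subseteq> (*\<^sub>R) (inverse b) ` (+) (- a) ` {x. \<phi> x \<noteq> 0}"
  proof
    fix x assume "x \<in> {x. \<phi> (a + b * x) \<noteq> 0}"
    then show "x \<in> (*\<^sub>R) (inverse b) ` (+) (- a) ` {x. \<phi> x \<noteq> 0}"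
      using \<open>b \<noteq> 0\<close> by (auto simp: image_image intro!: image_eqI[of _ _ "a + b * x"])
  qed
  moreover have "bounded ((*\<^sub>R) (inverse b) ` (+) (- a) ` {x. \<phi> x \<noteq> 0})"
    using \<phi> by (intro bounded_scaling bounded_translation) (simp add: test_fn_def)
  ultimately have "bounded {x. \<phi> (a + b * x) \<noteq> 0}" by (rule bounded_subset[rotated])
  with \<phi> show ?thesis by (simp add: test_fn_def smooth_fn_comp_affine)
qed

lemma test_fn_mult_integrable:
  fixes w :: "real \<Rightarrow> complex"
  assumes \<phi>: "test_fn \<phi>" and w: "continuous_on UNIV w"
  shows "integrable lborel (\<lambda>x. complex_of_real (\<phi> x) * w x)"
proof (rule integrable_continuous_bounded_support)
  show "continuous_on UNIV (\<lambda>x. complex_of_real (\<phi> x) * w x)"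
    by (intro continuous_intros test_fn_continuous[OF \<phi>] w)
  show "bounded {x. complex_of_real (\<phi> x) * w x \<noteq> 0}"
    by (rule bounded_subset[of "{x. \<phi> x \<noteq> 0}"]) (use \<phi> in \<open>auto simp: test_fn_def\<close>)
qed

lemma test_fn_integrable: "test_fn \<phi> \<Longrightarrow> integrable lborel \<phi>"
  by (simp add: test_fn_continuous integrable_continuous_bounded_support test_fn_def)

lemma test_fn_integration_by_parts:
  fixes w w' :: "real \<Rightarrow> complex"
  assumes \<phi>: "test_fn \<phi>" and w: "\<And>x. (w has_vector_derivative w' x) (at x)"
    and w': "continuous_on UNIV w'"
  shows "(LINT x|lborel. deriv \<phi> x * w x) = - (LINT x|lborel. \<phi> x * w' x)"
proof -
  have w_cont: "continuous_on UNIV w"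
    by (rule continuous_on_vector_derivative) (rule has_vector_derivative_at_within[OF w])
  have "(LINT x|lborel. complex_of_real (deriv \<phi> x) * w x + complex_of_real (\<phi> x) * w' x) = 0"
  proof (rule LINT_derivative_bounded_support)
    show "((\<lambda>x. complex_of_real (\<phi> x) * w x) has_vector_derivative
        complex_of_real (deriv \<phi> x) * w x + complex_of_real (\<phi> x) * w' x) (at x)" for x
      using has_vector_derivative_mult[OF
          has_vector_derivative_of_real[OF test_fn_has_derivative[OF \<phi>]] w]
      by (simp add: add.commute)
    show "continuous_on UNIV (\<lambda>x. complex_of_real (deriv \<phi> x) * w x + complex_of_real (\<phi> x) * w' x)"
      by (intro continuous_intros test_fn_continuous test_fn_deriv \<phi> w_cont w')
    show "bounded {x. complex_of_real (\<phi> x) * w x \<noteq> 0}"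
      by (rule bounded_subset[of "{x. \<phi> x \<noteq> 0}"]) (use \<phi> in \<open>auto simp: test_fn_def\<close>)
  qed
  then show ?thesis
    using test_fn_mult_integrable[OF \<phi> w'] test_fn_mult_integrable[OF test_fn_deriv[OF \<phi>] w_cont]
    by (simp add: eq_neg_iff_add_eq_0)
qed

definition exp_cutoff :: "real poly \<Rightarrow> real \<Rightarrow> real" where
  "exp_cutoff p x = (if x > 0 then poly p (1 / x) / exp (1 / x) else 0)"

lemma poly_div_exp_tendsto_0: "((\<lambda>x. poly p x / exp x) \<longlongrightarrow> (0::real)) at_top"
proof -
  have "((\<lambda>x. \<Sum>i\<le>degree p. coeff p i * (x ^ i / exp x)) \<longlongrightarrow> (\<Sum>i\<le>degree p. coeff p i * 0)) at_top"
    by (intro tendsto_intros tendsto_power_div_exp_0)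
  then show ?thesis by (simp add: poly_altdef sum_divide_distrib)
qed

lemma exp_cutoff_tendsto_0: "(exp_cutoff p \<longlongrightarrow> 0) (at 0)"
proof (rule filterlim_split_at)
  show "(exp_cutoff p \<longlongrightarrow> 0) (at_left 0)"
    by (rule tendsto_eventually) (auto simp: exp_cutoff_def eventually_at_filter)
  have "((\<lambda>x. poly p (inverse x) / exp (inverse x)) \<longlongrightarrow> (0::real)) (at_right 0)"
    by (rule filterlim_compose[OF poly_div_exp_tendsto_0 filterlim_inverse_at_top_right])
  then show "(exp_cutoff p \<longlongrightarrow> 0) (at_right 0)"
    by (rule Lim_transform_eventually)
      (auto simp: exp_cutoff_def eventually_at_filter inverse_eq_divide)
qed

lemma exp_cutoff_has_derivative:
  "(exp_cutoff p has_real_derivative exp_cutoff ([:0, 0, 1:] * (p - pderiv p)) x) (at x)"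
proof (cases x "0::real" rule: linorder_cases)
  case less
  then show ?thesis
    by (intro has_field_derivative_transform_within_open[OF DERIV_const[of 0],
          where S = "{..<0}", THEN DERIV_cong]) (auto simp: exp_cutoff_def)
next
  case equal
  have "(\<lambda>h. exp_cutoff p h / h) = exp_cutoff ([:0, 1:] * p)"
    by (auto simp: exp_cutoff_def fun_eq_iff)
  with exp_cutoff_tendsto_0[of "[:0, 1:] * p"] equal show ?thesis
    by (simp add: DERIV_def) (simp add: exp_cutoff_def)
next
  case greater
  have "((\<lambda>x. poly p (1 / x) * exp (- (1 / x))) has_real_derivative
      poly (pderiv p) (1 / x) * (- 1 / x\<^sup>2) * exp (- (1 / x))
        + poly p (1 / x) * (exp (- (1 / x)) * (1 / x\<^sup>2))) (at x)"
    using greater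
    by (auto intro!: derivative_eq_intros DERIV_chain2[OF poly_DERIV] simp: power2_eq_square)
  then have "((\<lambda>x. poly p (1 / x) * exp (- (1 / x))) has_real_derivative
      exp_cutoff ([:0, 0, 1:] * (p - pderiv p)) x) (at x)"
    by (rule DERIV_cong)
      (use greater in \<open>simp add: exp_cutoff_def exp_minus field_simps power2_eq_square\<close>)
  then show ?thesis
    by (rule has_field_derivative_transform_within_open[where S = "{0<..}"])
      (use greater in \<open>auto simp: exp_cutoff_def exp_minus divide_inverse\<close>)
qed

lemma smooth_fn_exp_cutoff: "smooth_fn (exp_cutoff p)"
  by (rule smooth_fn_family[where d = "\<lambda>p. [:0, 0, 1:] * (p - pderiv p)"])
    (rule exp_cutoff_has_derivative)

lemma ex_nonneg_test_fn: "\<exists>\<psi>. test_fn \<psi> \<and> (\<forall>x. \<psi> x \<ge> 0) \<and> \<psi> 0 > 0"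
proof -
  define \<psi> where "\<psi> x = exp_cutoff 1 (1 + 1 * x) * exp_cutoff 1 (1 + (-1) * x)" for x
  have "smooth_fn \<psi>" unfolding \<psi>_def
    by (intro smooth_fn_mult smooth_fn_comp_affine smooth_fn_exp_cutoff)
  moreover have "norm x \<le> 1" if "\<psi> x \<noteq> 0" for x
    using that by (auto simp: \<psi>_def exp_cutoff_def split: if_splits)
  ultimately have "test_fn \<psi>" by (auto simp: test_fn_def bounded_iff)
  then show ?thesis by (intro exI[of _ \<psi>]) (auto simp: \<psi>_def exp_cutoff_def)
qed

section \<open>Integrals depending on a parameter\<close>

lemma integrable_mult_bounded:
  fixes k F :: "'a \<Rightarrow> 'b::{real_normed_algebra, banach, second_countable_topology}"
  assumes k: "integrable M k" and F: "F \<in> borel_measurable M" "bounded (range F)"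
  shows "integrable M (\<lambda>x. k x * F x)"
proof -
  obtain B where B: "\<And>x. norm (F x) \<le> B" using F(2) by (auto simp: bounded_iff)
  show ?thesis
  proof (rule Bochner_Integration.integrable_bound)
    show "integrable M (\<lambda>x. norm (k x) * B)" using k by simp
    have "norm (k x * F x) \<le> norm (k x) * B" for x
      by (intro order_trans[OF norm_mult_ineq] mult_left_mono B norm_ge_zero)
    then show "AE x in M. norm (k x * F x) \<le> norm (norm (k x) * B)"
      by (intro AE_I2) (metis abs_ge_self order_trans real_norm_def)
  qed (use F(1) borel_measurable_integrable[OF k] in simp)
qed

lemma LINT_mult_bounded_tendsto:
  fixes k :: "'a \<Rightarrow> 'b::{real_normed_algebra, banach, second_countable_topology}"
  assumes k: "integrable M k" and F: "\<And>n. F n \<in> borel_measurable M"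
    and bound: "\<And>n x. norm (F n x) \<le> B" and lim: "\<And>x. (\<lambda>n. F n x) \<longlonglongrightarrow> c"
  shows "(\<lambda>n. LINT x|M. k x * F n x) \<longlonglongrightarrow> (LINT x|M. k x) * c"
proof -
  have [measurable]: "k \<in> borel_measurable M" using k by (rule borel_measurable_integrable)
  have "(\<lambda>n. LINT x|M. k x * F n x) \<longlonglongrightarrow> (LINT x|M. k x * c)"
  proof (rule integral_dominated_convergence[where w = "\<lambda>x. norm (k x) * B"])
    show "AE x in M. (\<lambda>n. k x * F n x) \<longlonglongrightarrow> k x * c"
      by (intro AE_I2 tendsto_mult_left lim)
    show "AE x in M. norm (k x * F n x) \<le> norm (k x) * B" for n
      by (intro AE_I2 order_trans[OF norm_mult_ineq] mult_left_mono bound) simp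
  qed (use k F in simp_all)
  with k show ?thesis by simp
qed

lemma LINT_mult_dilate_tendsto:
  fixes k F :: "real \<Rightarrow> 'b::{real_normed_algebra, banach, second_countable_topology}"
  assumes k: "integrable lborel k"
    and F[measurable]: "F \<in> borel_measurable borel"
    and bounded: "bounded (range F)" and cont: "isCont F x"
  shows "(\<lambda>n. LINT t|lborel. k t * F (x + inverse (real (Suc n)) * t))
    \<longlonglongrightarrow> (LINT t|lborel. k t) * F x"
proof -
  obtain B where B: "\<And>x. norm (F x) \<le> B" using bounded by (auto simp: bounded_iff)
  show ?thesis
  proof (rule LINT_mult_bounded_tendsto[OF k])
    have "(\<lambda>n. x + inverse (real (Suc n)) * t) \<longlonglongrightarrow> x" for t by real_asymp
    then show "(\<lambda>n. F (x + inverse (real (Suc n)) * t)) \<longlonglongrightarrow> F x" for t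
      by (rule isCont_tendsto_compose[OF cont])
  qed (use B in auto)
qed

lemma has_vector_derivative_iff_difference_quotient:
  "(f has_vector_derivative D) (at t) \<longleftrightarrow> ((\<lambda>h. (f (t + h) - f t) /\<^sub>R h) \<longlongrightarrow> D) (at 0)"
proof -
  have "norm (f (t + h) - f t - h *\<^sub>R D) / norm h = norm ((f (t + h) - f t) /\<^sub>R h - D)"
    if "h \<noteq> 0" for h
    using that norm_scaleR[of "inverse h" "f (t + h) - f t - h *\<^sub>R D"]
    by (simp add: scaleR_diff_right divide_inverse mult.commute)
  then have "((\<lambda>h. norm (f (t + h) - f t - h *\<^sub>R D) / norm h) \<longlongrightarrow> 0) (at 0) \<longleftrightarrow>
      ((\<lambda>h. norm ((f (t + h) - f t) /\<^sub>R h - D)) \<longlongrightarrow> 0) (at 0)"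
    by (intro filterlim_cong) (auto simp: eventually_at_filter)
  then show ?thesis
    by (simp add: has_vector_derivative_def has_derivative_at bounded_linear_scaleR_left
        tendsto_norm_zero_iff LIM_zero_iff)
qed

lemma has_vector_derivative_LINT:
  fixes f :: "real \<Rightarrow> 'a \<Rightarrow> 'b::{banach, second_countable_topology}"
  assumes f: "\<And>t. integrable M (f t)" and f'[measurable]: "f' \<in> borel_measurable M"
    and deriv: "\<And>s. ((\<lambda>t. f t s) has_vector_derivative f' s) (at t)"
    and lipschitz: "\<And>h s. norm (f (t + h) s - f t s) \<le> g s * \<bar>h\<bar>" and g: "integrable M g"
  shows "((\<lambda>t. LINT s|M. f t s) has_vector_derivative (LINT s|M. f' s)) (at t)"
proof -
  note difference_quotient_iff = has_vector_derivative_iff_difference_quotient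
    tendsto_at_iff_sequentially comp_def
  show ?thesis
    unfolding difference_quotient_iff
  proof (intro allI impI)
    fix h :: "nat \<Rightarrow> real" assume h_nonzero: "\<forall>n. h n \<in> UNIV - {0}" and h: "h \<longlonglongrightarrow> 0"
    have "(\<lambda>n. LINT s|M. (f (t + h n) s - f t s) /\<^sub>R h n) \<longlonglongrightarrow> (LINT s|M. f' s)"
    proof (rule integral_dominated_convergence[OF f' _ g])
      show "(\<lambda>s. (f (t + h n) s - f t s) /\<^sub>R h n) \<in> borel_measurable M" for n
        using f by (intro borel_measurable_integrable) simp
      show "AE s in M. (\<lambda>n. (f (t + h n) s - f t s) /\<^sub>R h n) \<longlonglongrightarrow> f' s"
        using deriv h_nonzero h unfolding difference_quotient_iff by simp
      show "AE s in M. norm ((f (t + h n) s - f t s) /\<^sub>R h n) \<le> g s" for n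
        using lipschitz[of "h n"] h_nonzero by (simp add: inverse_eq_divide pos_divide_le_eq)
    qed
    with f show "(\<lambda>n. ((LINT s|M. f (t + h n) s) - (LINT s|M. f t s)) /\<^sub>R h n)
        \<longlonglongrightarrow> (LINT s|M. f' s)"
      by simp
  qed
qed

lemma integrable_pair_dominated:
  fixes f :: "real \<Rightarrow> real \<Rightarrow> 'a::{banach, second_countable_topology}" and p q :: "real \<Rightarrow> real"
  assumes f[measurable]: "case_prod f \<in> borel_measurable (lborel \<Otimes>\<^sub>M lborel)"
    and p: "integrable lborel p" and q: "integrable lborel q"
    and le: "\<And>x y. norm (f x y) \<le> p x * q y"
  shows "integrable (lborel \<Otimes>\<^sub>M lborel) (case_prod f)"
proof (rule Bochner_Integration.integrable_bound)
  note [measurable] = borel_measurable_integrable[OF p] borel_measurable_integrable[OF q]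
  show "integrable (lborel \<Otimes>\<^sub>M lborel) (\<lambda>(x, y). p x * q y)"
    by (rule lborel_pair.Fubini_integrable) (use p q in \<open>auto simp: abs_mult\<close>)
  show "AE z in lborel \<Otimes>\<^sub>M lborel. norm (case_prod f z) \<le> norm (case z of (x, y) \<Rightarrow> p x * q y)"
    using le by (auto intro!: AE_I2 order_trans[OF _ abs_ge_self])
qed measurable

lemma integrable_translation:
  fixes k :: "real \<Rightarrow> 'a::{banach, second_countable_topology}"
  assumes "integrable lborel k" shows "integrable lborel (\<lambda>t. k (t - u))"
  using lborel_integrable_real_affine[OF assms, of 1 "- u"] by simp

lemma LINT_translation:
  fixes k :: "real \<Rightarrow> 'a::{banach, second_countable_topology}"
  shows "(LINT t|lborel. k (t - u)) = (LINT t|lborel. k t)"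
  using lborel_integral_real_affine[of 1 k "- u"] by simp

lemma integrable_convolution_integrand:
  fixes p k :: "real \<Rightarrow> 'a::{real_normed_algebra, banach, second_countable_topology}"
  assumes p: "integrable lborel p" and k: "integrable lborel k"
  shows "integrable (lborel \<Otimes>\<^sub>M lborel) (\<lambda>(u, t). p u * k (t - u))"
proof -
  note [measurable] = borel_measurable_integrable[OF p] borel_measurable_integrable[OF k]
  have "integrable (lborel \<Otimes>\<^sub>M lborel) (\<lambda>(u, t). norm (p u) * norm (k (t - u)))"
  proof (rule lborel_pair.Fubini_integrable)
    show "integrable lborel
        (\<lambda>u. LINT t|lborel. norm (case (u, t) of (u, t) \<Rightarrow> norm (p u) * norm (k (t - u))))"
      using p LINT_translation[of "\<lambda>t. norm (k t)"] by simp
  qed (use integrable_translation[OF integrable_norm[OF k]] in auto)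
  then show ?thesis
    by (rule Bochner_Integration.integrable_bound) (auto simp: norm_mult_ineq)
qed

lemma continuous_nonneg_LINT_eq_0:
  fixes f :: "'a::euclidean_space \<Rightarrow> real"
  assumes "continuous_on UNIV f" "\<And>x. 0 \<le> f x" "integrable lborel f" "(LINT x|lborel. f x) = 0"
  shows "f x = 0"
proof -
  have "AE x in lborel. f x = 0"
    using integral_nonneg_eq_0_iff_AE[OF assms(3)] assms(2,4) by simp
  then have "AE x in lebesgue. x \<in> {x. f x = 0}"
    using AE_completion[of "\<lambda>x. f x = 0" lborel] by simp
  moreover have "closed {x. f x = 0}"
    by (intro closed_Collect_eq assms(1) continuous_on_const)
  ultimately show ?thesis using mem_closed_if_AE_lebesgue[of "{x. f x = 0}" x] by simp
qed

section \<open>Functions orthogonal to the derivatives of a kernel\<close>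

locale integrable_C1_kernel =
  fixes k k' :: "real \<Rightarrow> 'a::{real_normed_field, euclidean_space}"
  assumes has_derivative: "\<And>x. (k has_vector_derivative k' x) (at x)"
    and continuous_derivative: "continuous_on UNIV k'"
    and integrable: "integrable lborel k"
    and integrable_derivative: "integrable lborel k'"
begin

lemma measurable [measurable]: "k \<in> borel_measurable borel" "k' \<in> borel_measurable borel"
  using integrable integrable_derivative by (auto dest: borel_measurable_integrable)

lemma LINT_derivative_translates:
  assumes "a \<le> b"
  shows "(LINT u|lborel. indicator {a..b} u *\<^sub>R k' (t - u)) = k (t - a) - k (t - b)"
proof -
  have "(LINT u|lborel. indicator {a..b} u *\<^sub>R k' (t - u)) = - k (t - b) - - k (t - a)"
  proof (rule integral_FTC_atLeastAtMost[OF assms])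
    show "((\<lambda>u. - k (t - u)) has_vector_derivative k' (t - u)) (at u within {a..b})" for u
    proof -
      have "((\<lambda>u. k (t - u)) has_vector_derivative (- 1) *\<^sub>R k' (t - u)) (at u within {a..b})"
        by (rule vector_diff_chain_within[of "\<lambda>u. t - u", unfolded o_def])
          (auto intro!: derivative_eq_intros has_vector_derivative_at_within[OF has_derivative])
      then show ?thesis by (auto intro!: derivative_eq_intros)
    qed
    show "continuous_on {a..b} (\<lambda>u. k' (t - u))"
      by (intro continuous_intros continuous_on_compose2[OF continuous_derivative]) auto
  qed
  then show ?thesis by simp
qed

lemma correlation_constant:
  assumes F: "F \<in> borel_measurable borel" "bounded (range F)"
    and orthogonal: "\<And>a. (LINT t|lborel. k' (t - a) * F t) = 0" and "a \<le> b"
  shows "(LINT t|lborel. k (t - a) * F t) = (LINT t|lborel. k (t - b) * F t)"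
proof -
  note [measurable] = F(1)
  define f where "f u t = (indicator {a..b} u *\<^sub>R k' (t - u)) * F t" for u t
  have "integrable lborel (\<lambda>u. indicator {a..b} u *\<^sub>R (1 :: 'a))"
    by (simp add: emeasure_lborel_Icc_eq)
  from integrable_convolution_integrand[OF this integrable_derivative]
  have "integrable (lborel \<Otimes>\<^sub>M lborel)
      (\<lambda>z. (case z of (u, t) \<Rightarrow> indicator {a..b} u *\<^sub>R 1 * k' (t - u)) * F (snd z))"
    using F(2) by (intro integrable_mult_bounded) (auto intro: bounded_subset)
  then have "integrable (lborel \<Otimes>\<^sub>M lborel) (case_prod f)"
    by (simp add: f_def case_prod_unfold)
  then have "(LINT u|lborel. LINT t|lborel. f u t) = (LINT t|lborel. LINT u|lborel. f u t)"
    by (rule lborel_pair.Fubini_integral[symmetric])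
  moreover have "(LINT t|lborel. f u t) = 0" for u
    unfolding f_def using orthogonal[of u] by simp
  moreover have "(LINT u|lborel. f u t) = k (t - a) * F t - k (t - b) * F t" for t
    unfolding f_def integral_mult_left_zero LINT_derivative_translates[OF \<open>a \<le> b\<close>]
    by (rule left_diff_distrib)
  moreover have "integrable lborel (\<lambda>t. k (t - u) * F t)" for u
    using F by (intro integrable_mult_bounded integrable_translation[OF integrable]) auto
  ultimately show ?thesis by simp
qed

lemma correlation_eq_0:
  assumes F: "F \<in> borel_measurable borel" "bounded (range F)" "(F \<longlongrightarrow> 0) at_bot"
    and orthogonal: "\<And>a. (LINT t|lborel. k' (t - a) * F t) = 0"
  shows "(LINT t|lborel. k t * F t) = 0"
proof -
  note [measurable] = F(1)
  obtain B where B: "\<And>x. norm (F x) \<le> B" using F(2) by (auto simp: bounded_iff)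
  have "(\<lambda>n. LINT t|lborel. k t * F (t - real n)) \<longlonglongrightarrow> (LINT t|lborel. k t) * 0"
  proof (rule LINT_mult_bounded_tendsto[OF integrable])
    have "filterlim (\<lambda>n. t - real n) at_bot sequentially" for t by real_asymp
    then show "(\<lambda>n. F (t - real n)) \<longlonglongrightarrow> 0" for t by (rule filterlim_compose[OF F(3)])
  qed (use B in auto)
  moreover have "(LINT t|lborel. k t * F (t - real n)) = (LINT t|lborel. k t * F t)" for n
  proof -
    have "(LINT t|lborel. k t * F (t - real n)) = (LINT t|lborel. k (t + real n) * F t)"
      using LINT_translation[of "\<lambda>t. k (t + real n) * F t" "real n"] by simp
    also have "\<dots> = (LINT t|lborel. k t * F t)"
      using correlation_constant[OF F(1,2) orthogonal, of "- real n" 0] by simp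
    finally show ?thesis .
  qed
  ultimately show ?thesis by (simp add: LIMSEQ_const_iff)
qed

lemma eq_0_if_orthogonal_to_dilates:
  assumes F: "continuous_on UNIV F" "bounded (range F)" "(F \<longlongrightarrow> 0) at_bot"
    and mass: "(LINT t|lborel. k t) \<noteq> 0"
    and orthogonal: "\<And>a \<epsilon>. \<epsilon> > 0 \<Longrightarrow> (LINT t|lborel. k' ((t - a) / \<epsilon>) * F t) = 0"
  shows "F x = 0"
proof -
  have F_measurable [measurable]: "F \<in> borel_measurable borel"
    by (rule borel_measurable_continuous_onI[OF F(1)])
  have "(LINT t|lborel. k t * F (x + \<epsilon> * t)) = 0" if \<epsilon>: "\<epsilon> > 0" for \<epsilon>
  proof (rule correlation_eq_0)
    show "bounded (range (\<lambda>t. F (x + \<epsilon> * t)))" using F(2) by (auto intro: bounded_subset)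
    have "filterlim (\<lambda>t. x + \<epsilon> * t) at_bot at_bot" using \<epsilon> by real_asymp
    then show "((\<lambda>t. F (x + \<epsilon> * t)) \<longlongrightarrow> 0) at_bot" by (rule filterlim_compose[OF F(3)])
    show "(LINT t|lborel. k' (t - a) * F (x + \<epsilon> * t)) = 0" for a
      using orthogonal[OF \<epsilon>, of "x + \<epsilon> * a"] \<epsilon>
        lborel_integral_real_affine[of \<epsilon> "\<lambda>t. k' ((t - (x + \<epsilon> * a)) / \<epsilon>) * F t" x]
      by (simp add: diff_divide_distrib add_divide_distrib)
  qed measurable
  then have "(\<lambda>n. LINT t|lborel. k t * F (x + inverse (real (Suc n)) * t)) = (\<lambda>n. 0)" by simp
  moreover have "isCont F x" using F(1) by (simp add: continuous_on_eq_continuous_at)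
  from LINT_mult_dilate_tendsto[OF integrable F_measurable F(2) this]
  have "(\<lambda>n. LINT t|lborel. k t * F (x + inverse (real (Suc n)) * t))
      \<longlonglongrightarrow> (LINT t|lborel. k t) * F x" .
  ultimately show ?thesis using mass by (simp add: LIMSEQ_const_iff)
qed

end

section \<open>The Fourier transform\<close>

definition fourier :: "(real \<Rightarrow> complex) \<Rightarrow> real \<Rightarrow> complex" where
  "fourier f t = (LINT s|lborel. f s * cis (- (s * t)))"

abbreviation fourier_real :: "(real \<Rightarrow> real) \<Rightarrow> real \<Rightarrow> complex" where
  "fourier_real f \<equiv> fourier (\<lambda>s. of_real (f s))"

lemma borel_measurable_cis [measurable]: "cis \<in> borel_measurable borel"
  by (intro borel_measurable_continuous_onI continuous_intros)

lemma norm_cis_diff_1_le: "cmod (cis x - 1) \<le> \<bar>x\<bar>"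
  using iexp_approx1[of x 0] by (simp add: cis_conv_exp)

lemma integrable_mult_cis:
  assumes f: "integrable lborel f" and c: "c \<in> borel_measurable borel"
  shows "integrable lborel (\<lambda>s. f s * cis (c s))"
  using c by (intro integrable_mult_bounded[OF f]) (auto simp: bounded_iff)

lemma fourier_add:
  assumes "integrable lborel f" "integrable lborel g"
  shows "fourier (\<lambda>s. f s + g s) t = fourier f t + fourier g t"
  using assms by (simp add: fourier_def distrib_right integrable_mult_cis)

lemma fourier_cmult: "fourier (\<lambda>s. c * f s) t = c * fourier f t"
  by (simp add: fourier_def mult.assoc)

lemma fourier_modulate: "fourier (\<lambda>s. cis (a * s) * f s) t = fourier f (t - a)"
proof -
  have "cis (a * s) * f s * cis (- (s * t)) = f s * cis (- (s * (t - a)))" for s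
    by (simp add: cis_mult right_diff_distrib mult.commute mult.left_commute)
  then show ?thesis by (simp only: fourier_def)
qed

lemma fourier_dilate: "b \<noteq> 0 \<Longrightarrow> fourier (\<lambda>s. f (b * s)) t = fourier f (t / b) / of_real \<bar>b\<bar>"
  using lborel_integral_real_affine[of b "\<lambda>s. f s * cis (- (s * (t / b)))" 0]
  by (simp add: fourier_def scaleR_conv_of_real)

lemma norm_fourier_le: "cmod (fourier f t) \<le> (LINT s|lborel. cmod (f s))"
  using integral_norm_bound[of lborel "\<lambda>s. f s * cis (- (s * t))"]
  by (simp add: fourier_def norm_mult)

lemma fourier_has_derivative:
  assumes f: "integrable lborel f" and sf: "integrable lborel (\<lambda>s. of_real s * f s)"
  shows "(fourier f has_vector_derivative fourier (\<lambda>s. - \<i> * of_real s * f s) t) (at t)"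
  unfolding fourier_def
proof (rule has_vector_derivative_LINT[where g = "\<lambda>s. cmod (of_real s * f s)"])
  show "integrable lborel (\<lambda>s. f s * cis (- (s * t)))" for t
    by (rule integrable_mult_cis[OF f]) simp
  have "integrable lborel (\<lambda>s. (- \<i> * (of_real s * f s)) * cis (- (s * t)))"
    by (rule integrable_mult_cis) (use sf in auto)
  then show "(\<lambda>s. - \<i> * of_real s * f s * cis (- (s * t))) \<in> borel_measurable lborel"
    by (simp add: mult.assoc borel_measurable_integrable)
  show "((\<lambda>t. f s * cis (- (s * t))) has_vector_derivative
      - \<i> * of_real s * f s * cis (- (s * t))) (at t)" for s
    by (auto intro!: derivative_eq_intros simp: has_vector_derivative_def scaleR_conv_of_real)
  show "cmod (f s * cis (- (s * (t + h))) - f s * cis (- (s * t)))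
      \<le> cmod (of_real s * f s) * \<bar>h\<bar>" for s h
  proof -
    have "f s * cis (- (s * (t + h))) - f s * cis (- (s * t))
        = f s * cis (- (s * t)) * (cis (- (s * h)) - 1)"
      by (simp add: algebra_simps cis_mult)
    then show ?thesis
      using mult_left_mono[OF norm_cis_diff_1_le[of "- (s * h)"], of "cmod (f s)"]
      by (simp add: norm_mult abs_mult mult_ac)
  qed
  show "integrable lborel (\<lambda>s. cmod (of_real s * f s))" using sf by (rule integrable_norm)
qed

lemma fourier_continuous:
  assumes "integrable lborel f" "integrable lborel (\<lambda>s. of_real s * f s)"
  shows "continuous_on S (fourier f)"
  by (rule continuous_on_vector_derivative)
    (rule has_vector_derivative_at_within[OF fourier_has_derivative[OF assms]])

lemma LINT_fourier_mult_swap: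
  assumes f: "integrable lborel f" and g: "integrable lborel g"
  shows "(LINT t|lborel. fourier f t * g t) = (LINT s|lborel. f s * fourier g s)"
proof -
  note [measurable] = borel_measurable_integrable[OF f] borel_measurable_integrable[OF g]
  let ?h = "\<lambda>s t. f s * g t * cis (- (s * t))"
  have "integrable (lborel \<Otimes>\<^sub>M lborel) (case_prod ?h)"
    by (rule integrable_pair_dominated[OF _ integrable_norm[OF f] integrable_norm[OF g]])
      (simp_all add: norm_mult)
  then have "(LINT t|lborel. LINT s|lborel. ?h s t) = (LINT s|lborel. LINT t|lborel. ?h s t)"
    by (rule lborel_pair.Fubini_integral)
  moreover have "(LINT s|lborel. ?h s t) = fourier f t * g t" for t
    by (simp add: fourier_def mult.assoc mult.left_commute[of _ "g t"] mult.commute[of _ "g t"])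
  moreover have "(LINT t|lborel. ?h s t) = f s * fourier g s" for s
    by (simp add: fourier_def mult.assoc mult.commute[of s])
  ultimately show ?thesis by simp
qed

lemma fourier_std_normal_density:
  "fourier_real std_normal_density t = of_real (sqrt (2 * pi) * std_normal_density t)"
proof -
  have "fourier_real std_normal_density t = char std_normal_distribution (- t)"
    unfolding fourier_def char_def
    by (subst integral_density)
      (auto simp: normal_density_nonneg cis_conv_exp scaleR_conv_of_real mult_ac)
  then show ?thesis
    by (simp only: char_std_normal_distribution) (simp add: std_normal_density_def)
qed

lemma LINT_fourier_mult_std_normal_density:
  assumes f: "integrable lborel f" and \<epsilon>: "\<epsilon> > 0"
  shows "(LINT t|lborel. cis (x * t) * fourier f t * of_real (std_normal_density (\<epsilon> * t)))
    = of_real (sqrt (2 * pi)) * (LINT u|lborel. of_real (std_normal_density u) * f (x + \<epsilon> * u))"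
proof -
  let ?G = "\<lambda>t. complex_of_real (std_normal_density t)"
  let ?g = "\<lambda>t. cis (x * t) * ?G (\<epsilon> * t)"
  have "integrable lborel (\<lambda>t. ?G (\<epsilon> * t) * cis (x * t))"
    using lborel_integrable_real_affine[of ?G \<epsilon> 0] \<epsilon> by (intro integrable_mult_cis) auto
  then have g: "integrable lborel ?g" by (simp only: mult.commute)
  have fourier_g: "fourier ?g s = of_real (sqrt (2 * pi) / \<epsilon>) * ?G ((s - x) / \<epsilon>)" for s
    using \<epsilon> by (simp add: fourier_modulate fourier_dilate[of \<epsilon> ?G] fourier_std_normal_density)
  have "(LINT t|lborel. cis (x * t) * fourier f t * ?G (\<epsilon> * t))
      = (LINT t|lborel. fourier f t * ?g t)"
    by (simp only: mult_ac)
  also have "\<dots> = (LINT s|lborel. f s * fourier ?g s)" by (rule LINT_fourier_mult_swap[OF f g])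
  also have "\<dots> = of_real (sqrt (2 * pi) / \<epsilon>) * (LINT s|lborel. ?G ((s - x) / \<epsilon>) * f s)"
    unfolding fourier_g by (subst integral_mult_right_zero[symmetric]) (simp only: mult_ac)
  also have "(LINT s|lborel. ?G ((s - x) / \<epsilon>) * f s)
      = of_real \<epsilon> * (LINT u|lborel. ?G u * f (x + \<epsilon> * u))"
    using \<epsilon> lborel_integral_real_affine[of \<epsilon> "\<lambda>s. ?G ((s - x) / \<epsilon>) * f s" x]
    by (simp add: scaleR_conv_of_real)
  finally show ?thesis using \<epsilon> by simp
qed

lemma fourier_inversion:
  assumes f: "integrable lborel f" "bounded (range f)" "isCont f x"
    and fourier_f: "integrable lborel (fourier f)"
  shows "(LINT t|lborel. cis (x * t) * fourier f t) = 2 * of_real pi * f x"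
proof -
  let ?G = "\<lambda>t. complex_of_real (std_normal_density t)" and ?\<epsilon> = "\<lambda>n. inverse (real (Suc n))"
  have "(\<lambda>n. LINT t|lborel. cis (x * t) * fourier f t * ?G (0 + ?\<epsilon> n * t))
      \<longlonglongrightarrow> (LINT t|lborel. cis (x * t) * fourier f t) * ?G 0"
  proof (rule LINT_mult_dilate_tendsto)
    show "integrable lborel (\<lambda>t. cis (x * t) * fourier f t)"
      using integrable_mult_cis[OF fourier_f, of "\<lambda>t. x * t"] by (simp add: mult.commute)
    show "bounded (range ?G)"
      unfolding bounded_iff
      by (rule exI[of _ "std_normal_density 0"])
        (auto simp: std_normal_density_def norm_divide divide_right_mono)
    show "isCont ?G 0" unfolding std_normal_density_def by (intro continuous_intros) simp
  qed measurable
  then have fourier_side: "(\<lambda>n. LINT t|lborel. cis (x * t) * fourier f t * ?G (?\<epsilon> n * t))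
      \<longlonglongrightarrow> (LINT t|lborel. cis (x * t) * fourier f t) * ?G 0" by simp
  have "(\<lambda>n. of_real (sqrt (2 * pi)) * (LINT u|lborel. ?G u * f (x + ?\<epsilon> n * u)))
      \<longlonglongrightarrow> of_real (sqrt (2 * pi)) * ((LINT u|lborel. ?G u) * f x)"
    using borel_measurable_integrable[OF f(1)] f(2,3)
    by (intro tendsto_mult_left LINT_mult_dilate_tendsto) simp_all
  then have "(\<lambda>n. LINT t|lborel. cis (x * t) * fourier f t * ?G (?\<epsilon> n * t))
      \<longlonglongrightarrow> of_real (sqrt (2 * pi)) * ((LINT u|lborel. ?G u) * f x)"
    by (subst LINT_fourier_mult_std_normal_density[OF f(1)]) simp_all
  with fourier_side have limits: "(LINT t|lborel. cis (x * t) * fourier f t) * ?G 0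
      = of_real (sqrt (2 * pi)) * ((LINT u|lborel. ?G u) * f x)"
    by (rule LIMSEQ_unique)
  have G_0: "of_real (sqrt (2 * pi)) * ?G 0 = 1"
    unfolding of_real_mult[symmetric] by (simp add: std_normal_density_def)
  have sqrt_square: "complex_of_real (sqrt (2 * pi)) * of_real (sqrt (2 * pi)) = 2 * of_real pi"
    unfolding of_real_mult[symmetric] by simp
  have "(LINT t|lborel. cis (x * t) * fourier f t)
      = of_real (sqrt (2 * pi)) * ((LINT t|lborel. cis (x * t) * fourier f t) * ?G 0)"
    by (simp only: mult.left_commute[of "complex_of_real (sqrt (2 * pi))"] G_0 mult_1_right)
  also have "\<dots> = 2 * of_real pi * f x"
    unfolding limits mult.assoc[symmetric] sqrt_square by simp
  finally show ?thesis .
qed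

lemma integrable_inverse_one_plus_square: "integrable lborel (\<lambda>x::real. inverse (1 + x\<^sup>2))"
  using integrable_inverse_1_plus_square by (simp add: set_integrable_def)

lemma integrable_if_inverse_square_decay:
  fixes f :: "real \<Rightarrow> 'a::{banach, second_countable_topology}"
  assumes "f \<in> borel_measurable borel" and decay: "\<And>x. (1 + x\<^sup>2) * norm (f x) \<le> C"
  shows "integrable lborel f"
proof (rule Bochner_Integration.integrable_bound)
  show "integrable lborel (\<lambda>x. C * inverse (1 + x\<^sup>2))"
    by (intro integrable_mult_right integrable_inverse_one_plus_square)
  have "norm (f x) \<le> C * inverse (1 + x\<^sup>2)" for x
    using decay[of x] add_pos_nonneg[OF zero_less_one zero_le_power2[of x]]
    by (simp add: field_simps)
  then show "AE x in lborel. norm (f x) \<le> norm (C * inverse (1 + x\<^sup>2))"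
    by (intro AE_I2) (metis abs_ge_self order_trans real_norm_def)
qed (use assms(1) in simp)

section \<open>Kernels from test functions\<close>

lemma test_fn_of_real_integrable: "test_fn \<phi> \<Longrightarrow> integrable lborel (\<lambda>s. complex_of_real (\<phi> s))"
  using test_fn_integrable by simp

lemma test_fn_mult_ident: "test_fn \<phi> \<Longrightarrow> test_fn (\<lambda>s. s * \<phi> s)"
  using test_fn_mult[OF smooth_fn_linear[of 1 0]] by simp

lemma integrable_C1_kernel_test_fn:
  assumes \<phi>: "test_fn \<phi>"
  shows "integrable_C1_kernel (\<lambda>x. complex_of_real (\<phi> x)) (\<lambda>x. complex_of_real (deriv \<phi> x))"
  by standard
    (auto intro!: has_vector_derivative_of_real test_fn_has_derivative continuous_intros
      test_fn_continuous test_fn_deriv test_fn_of_real_integrable \<phi>)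

lemma fourier_test_fn_deriv:
  assumes \<phi>: "test_fn \<phi>"
  shows "fourier_real (deriv \<phi>) t = \<i> * of_real t * fourier_real \<phi> t"
proof -
  have "((\<lambda>s. cis (- (s * t))) has_vector_derivative
      - (\<i> * of_real t) * cis (- (s * t))) (at s)" for s
    by (auto intro!: derivative_eq_intros simp: has_vector_derivative_def scaleR_conv_of_real)
  then have "fourier_real (deriv \<phi>) t
      = - (LINT s|lborel. of_real (\<phi> s) * (- (\<i> * of_real t) * cis (- (s * t))))"
    unfolding fourier_def by (rule test_fn_integration_by_parts[OF \<phi>]) (intro continuous_intros)
  also have "\<dots> = - (LINT s|lborel. - (\<i> * of_real t) * (of_real (\<phi> s) * cis (- (s * t))))"
    by (simp only: mult.left_commute)
  also have "\<dots> = \<i> * of_real t * fourier_real \<phi> t"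
    unfolding integral_mult_right_zero fourier_def by simp
  finally show ?thesis .
qed

lemma fourier_test_fn_continuous:
  assumes \<phi>: "test_fn \<phi>" shows "continuous_on S (fourier_real \<phi>)"
  using test_fn_of_real_integrable[OF test_fn_mult_ident[OF \<phi>]]
  by (intro fourier_continuous test_fn_of_real_integrable[OF \<phi>]) simp

lemma fourier_test_fn_integrable:
  assumes \<phi>: "test_fn \<phi>" shows "integrable lborel (fourier_real \<phi>)"
proof (rule integrable_if_inverse_square_decay)
  show "fourier_real \<phi> \<in> borel_measurable borel"
    by (intro borel_measurable_continuous_onI fourier_test_fn_continuous \<phi>)
  fix t
  let ?\<phi>'' = "deriv (deriv \<phi>)"
  have "t\<^sup>2 * cmod (fourier_real \<phi> t) = cmod (fourier_real ?\<phi>'' t)"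
    by (simp add: fourier_test_fn_deriv test_fn_deriv \<phi> norm_mult power2_eq_square mult.assoc
        flip: abs_mult)
  then show "(1 + t\<^sup>2) * cmod (fourier_real \<phi> t)
      \<le> (LINT s|lborel. cmod (of_real (\<phi> s))) + (LINT s|lborel. cmod (of_real (?\<phi>'' s)))"
    unfolding distrib_right by (simp only: mult_1 add_mono norm_fourier_le)
qed

definition fourier_derivative :: "(real \<Rightarrow> complex) \<Rightarrow> real \<Rightarrow> complex" where
  "fourier_derivative f = fourier (\<lambda>s. - \<i> * of_real s * f s)"

abbreviation fourier_derivative_real :: "(real \<Rightarrow> real) \<Rightarrow> real \<Rightarrow> complex" where
  "fourier_derivative_real f \<equiv> fourier_derivative (\<lambda>s. of_real (f s))"

lemma fourier_derivative_add:
  assumes f: "integrable lborel (\<lambda>s. of_real s * f s)"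
    and g: "integrable lborel (\<lambda>s. of_real s * g s)"
  shows "fourier_derivative (\<lambda>s. f s + g s) t = fourier_derivative f t + fourier_derivative g t"
  unfolding fourier_derivative_def mult.assoc fourier_cmult distrib_left[of "of_real _"]
  by (simp add: fourier_add[OF f g] distrib_left)

lemma fourier_derivative_cmult: "fourier_derivative (\<lambda>s. c * f s) t = c * fourier_derivative f t"
  unfolding fourier_derivative_def mult.left_commute[of _ c] fourier_cmult ..

lemma fourier_derivative_real_eq:
  "fourier_derivative_real \<phi> = (\<lambda>t. - \<i> * fourier_real (\<lambda>s. s * \<phi> s) t)"
  by (simp add: fourier_derivative_def mult.assoc fun_eq_iff flip: fourier_cmult)

lemma integrable_C1_kernel_fourier:
  assumes \<phi>: "test_fn \<phi>"
  shows "integrable_C1_kernel (fourier_real \<phi>) (fourier_derivative_real \<phi>)"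
proof
  note s\<phi> = test_fn_mult_ident[OF \<phi>]
  show "(fourier_real \<phi> has_vector_derivative fourier_derivative_real \<phi> t) (at t)" for t
    unfolding fourier_derivative_def
    using test_fn_of_real_integrable[OF \<phi>] test_fn_of_real_integrable[OF s\<phi>]
    by (intro fourier_has_derivative) simp_all
  show "continuous_on UNIV (fourier_derivative_real \<phi>)"
    unfolding fourier_derivative_real_eq by (intro continuous_intros fourier_test_fn_continuous s\<phi>)
  show "integrable lborel (fourier_derivative_real \<phi>)"
    unfolding fourier_derivative_real_eq using fourier_test_fn_integrable[OF s\<phi>] by simp
qed (rule fourier_test_fn_integrable[OF \<phi>])

lemma LINT_fourier_test_fn:
  assumes \<phi>: "test_fn \<phi>"
  shows "(LINT t|lborel. fourier_real \<phi> t) = 2 * of_real pi * of_real (\<phi> 0)"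
proof -
  have "bounded (range (\<lambda>s. complex_of_real (\<phi> s)))"
    using test_fn_bounded[OF \<phi>] by (auto simp: bounded_iff)
  moreover have "isCont (\<lambda>s. complex_of_real (\<phi> s)) 0"
    using test_fn_continuous[OF \<phi>, of UNIV] by (simp add: continuous_on_eq_continuous_at)
  ultimately show ?thesis
    using fourier_inversion[of "\<lambda>s. complex_of_real (\<phi> s)" 0] test_fn_of_real_integrable[OF \<phi>]
      fourier_test_fn_integrable[OF \<phi>] by simp
qed

lemma fourier_derivative_modulate_dilate:
  assumes "\<epsilon> > 0"
  shows "fourier_derivative (\<lambda>s. cis (a * s) * f (\<epsilon> * s)) t
    = fourier_derivative f ((t - a) / \<epsilon>) / of_real (\<epsilon>\<^sup>2)"
proof -
  let ?g = "\<lambda>s. - \<i> * of_real s * f s"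
  have "fourier_derivative (\<lambda>s. cis (a * s) * f (\<epsilon> * s)) t
      = fourier (\<lambda>s. cis (a * s) * (1 / of_real \<epsilon> * ?g (\<epsilon> * s))) t"
    using assms by (simp add: fourier_derivative_def mult_ac)
  also have "\<dots> = 1 / of_real \<epsilon> * (fourier ?g ((t - a) / \<epsilon>) / of_real \<epsilon>)"
    unfolding fourier_modulate fourier_cmult using assms fourier_dilate[of \<epsilon> ?g] by simp
  finally show ?thesis by (simp add: fourier_derivative_def power2_eq_square)
qed

lemma fourier_derivative_test_fn_translate_dilate:
  assumes \<psi>: "test_fn \<psi>" and \<epsilon>: "\<epsilon> > 0"
  obtains c d where "test_fn c" "test_fn d"
    "\<And>t. fourier_derivative_real \<psi> ((t - a) / \<epsilon>)
      = of_real (\<epsilon>\<^sup>2) * (fourier_derivative_real c t + \<i> * fourier_derivative_real d t)"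
proof
  define c d where "c s = cos (a * s) * \<psi> (\<epsilon> * s)" and "d s = sin (a * s) * \<psi> (\<epsilon> * s)" for s
  have "test_fn (\<lambda>s. \<psi> (\<epsilon> * s))"
    using test_fn_comp_affine[OF \<psi>, of \<epsilon> 0] \<epsilon> by simp
  then show c: "test_fn c" and d: "test_fn d"
    using smooth_fn_cos_sin[of 1 a 0] smooth_fn_cos_sin[of 0 a 1]
    by (simp_all add: c_def[abs_def] d_def[abs_def] test_fn_mult)
  fix t
  have "fourier_derivative_real \<psi> ((t - a) / \<epsilon>) / of_real (\<epsilon>\<^sup>2)
      = fourier_derivative (\<lambda>s. cis (a * s) * of_real (\<psi> (\<epsilon> * s))) t"
    by (rule fourier_derivative_modulate_dilate[OF \<epsilon>, symmetric])
  also have "(\<lambda>s. cis (a * s) * of_real (\<psi> (\<epsilon> * s))) = (\<lambda>s. of_real (c s) + \<i> * of_real (d s))"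
    by (simp add: c_def d_def fun_eq_iff complex_eq_iff)
  also have "fourier_derivative \<dots> t
      = fourier_derivative_real c t + \<i> * fourier_derivative_real d t"
    using test_fn_of_real_integrable[OF test_fn_mult_ident[OF c]]
      test_fn_of_real_integrable[OF test_fn_mult_ident[OF d]]
    by (simp add: fourier_derivative_add fourier_derivative_cmult mult.left_commute)
  finally show "fourier_derivative_real \<psi> ((t - a) / \<epsilon>)
      = of_real (\<epsilon>\<^sup>2) * (fourier_derivative_real c t + \<i> * fourier_derivative_real d t)"
    using \<epsilon> by (simp add: field_simps)
qed

section \<open>Integral operators on the space of primitives\<close>

definition integral_operator :: "('b \<Rightarrow> real \<Rightarrow> complex) \<Rightarrow> (real \<Rightarrow> complex) \<Rightarrow> 'b \<Rightarrow> complex" where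
  "integral_operator w F y = (LINT x|lborel. w y x * F x)"

lemma Bc_measurable: "F \<in> Bc \<Longrightarrow> F \<in> borel_measurable borel"
  by (simp add: Bc_continuous borel_measurable_continuous_onI)

lemma integrable_mult_Bc: "integrable lborel k \<Longrightarrow> F \<in> Bc \<Longrightarrow> integrable lborel (\<lambda>x. k x * F x)"
  by (intro integrable_mult_bounded) (simp_all add: Bc_measurable Bc_bounded)

lemma clinear_on_Bc_if_integral_operator:
  assumes \<Phi>: "\<And>F. F \<in> Bc \<Longrightarrow> \<Phi> F = integral_operator w F" and w: "\<And>y. integrable lborel (w y)"
  shows "clinear_on Bc \<Phi>"
proof -
  have "integral_operator w (\<lambda>x. F x + G x)
      = (\<lambda>y. integral_operator w F y + integral_operator w G y)"
    if "F \<in> Bc" "G \<in> Bc" for F G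
    using that by (simp add: integral_operator_def fun_eq_iff distrib_left integrable_mult_Bc[OF w])
  moreover have "integral_operator w (\<lambda>x. c * F x) = (\<lambda>y. c * integral_operator w F y)" for c F
    by (simp add: integral_operator_def fun_eq_iff mult.left_commute[of _ c])
  ultimately show ?thesis
    by (simp add: clinear_on_def \<Phi> cspace_add[OF cspace_Bc] cspace_scale[OF cspace_Bc])
qed

lemma Bc_eq_0_if_orthogonal_to_dilates:
  assumes "integrable_C1_kernel k k'" "F \<in> Bc" "(LINT t|lborel. k t) \<noteq> 0"
    and "\<And>a \<epsilon>. \<epsilon> > 0 \<Longrightarrow> (LINT t|lborel. k' ((t - a) / \<epsilon>) * F t) = 0"
  shows "F = (\<lambda>x. 0)"
  using integrable_C1_kernel.eq_0_if_orthogonal_to_dilates[OF assms(1), of F] assms(2-)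
  by (simp add: fun_eq_iff Bc_continuous Bc_bounded Bc_tendsto_at_bot)

lemma Bc_eq_0_if_orthogonal_to_derivatives:
  assumes F: "F \<in> Bc" and orthogonal: "\<And>\<phi>. test_fn \<phi> \<Longrightarrow> (LINT t|lborel. deriv \<phi> t * F t) = 0"
  shows "F = (\<lambda>x. 0)"
proof -
  obtain \<psi> where \<psi>: "test_fn \<psi>" "\<And>x. \<psi> x \<ge> 0" "\<psi> 0 > 0" using ex_nonneg_test_fn by blast
  show ?thesis
  proof (rule Bc_eq_0_if_orthogonal_to_dilates[OF integrable_C1_kernel_test_fn[OF \<psi>(1)] F])
    have "(LINT t|lborel. \<psi> t) \<noteq> 0"
      using continuous_nonneg_LINT_eq_0[of \<psi> 0] \<psi> test_fn_continuous test_fn_integrable by fastforce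
    then show "(LINT t|lborel. complex_of_real (\<psi> t)) \<noteq> 0" by simp
    fix a \<epsilon> :: real assume \<epsilon>: "\<epsilon> > 0"
    define \<phi> where "\<phi> t = \<psi> (- a / \<epsilon> + 1 / \<epsilon> * t)" for t
    have "test_fn \<phi>" unfolding \<phi>_def using \<epsilon> by (intro test_fn_comp_affine[OF \<psi>(1)]) simp
    have "deriv \<phi> t = 1 / \<epsilon> * deriv \<psi> (- a / \<epsilon> + 1 / \<epsilon> * t)" for t
      unfolding \<phi>_def
      by (intro DERIV_imp_deriv has_real_derivative_comp_affine test_fn_has_derivative \<psi>)
    then have "deriv \<phi> t = 1 / \<epsilon> * deriv \<psi> ((t - a) / \<epsilon>)" for t
      by (simp add: diff_divide_distrib)
    then have "(LINT t|lborel. deriv \<phi> t * F t)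
        = (LINT t|lborel. of_real (1 / \<epsilon>) * (of_real (deriv \<psi> ((t - a) / \<epsilon>)) * F t))"
      by (simp add: mult.assoc)
    also have "\<dots> = of_real (1 / \<epsilon>) * (LINT t|lborel. of_real (deriv \<psi> ((t - a) / \<epsilon>)) * F t)"
      by (rule integral_mult_right_zero)
    finally show "(LINT t|lborel. of_real (deriv \<psi> ((t - a) / \<epsilon>)) * F t) = 0"
      using orthogonal[OF \<open>test_fn \<phi>\<close>] \<epsilon> by simp
  qed
qed

lemma Bc_eq_0_if_orthogonal_to_fourier_derivatives:
  assumes F: "F \<in> Bc"
    and orthogonal: "\<And>\<phi>. test_fn \<phi> \<Longrightarrow> (LINT t|lborel. fourier_derivative_real \<phi> t * F t) = 0"
  shows "F = (\<lambda>x. 0)"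
proof -
  obtain \<psi> where \<psi>: "test_fn \<psi>" "\<psi> 0 > 0" using ex_nonneg_test_fn by blast
  show ?thesis
  proof (rule Bc_eq_0_if_orthogonal_to_dilates[OF integrable_C1_kernel_fourier[OF \<psi>(1)] F])
    show "(LINT t|lborel. fourier_real \<psi> t) \<noteq> 0"
      using \<psi> by (simp add: LINT_fourier_test_fn)
    fix a \<epsilon> :: real assume \<epsilon>: "\<epsilon> > 0"
    obtain c d where cd: "test_fn c" "test_fn d"
      and \<psi>_eq: "\<And>t. fourier_derivative_real \<psi> ((t - a) / \<epsilon>)
        = of_real (\<epsilon>\<^sup>2) * (fourier_derivative_real c t + \<i> * fourier_derivative_real d t)"
      using fourier_derivative_test_fn_translate_dilate[OF \<psi>(1) \<epsilon>] by blast
    have "integrable lborel (\<lambda>t. fourier_derivative_real \<phi> t * F t)" if "test_fn \<phi>" for \<phi>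
      using integrable_C1_kernel.integrable_derivative[OF integrable_C1_kernel_fourier[OF that]] F
      by (rule integrable_mult_Bc)
    then show "(LINT t|lborel. fourier_derivative_real \<psi> ((t - a) / \<epsilon>) * F t) = 0"
      unfolding \<psi>_eq using orthogonal cd by (simp add: mult.assoc distrib_right)
  qed
qed

section \<open>Distributional derivatives of primitives\<close>

definition dderiv_fun :: "(real \<Rightarrow> complex) \<Rightarrow> distr" where
  "dderiv_fun F = distr_of (dderiv (dist_fun F))"

lemma dderiv_fun_test_fn:
  assumes F: "F \<in> Bc" and \<phi>: "test_fn \<phi>"
  shows "dderiv_fun F \<phi> = - (LINT x|lborel. deriv \<phi> x * F x)"
proof -
  have "integral UNIV (\<lambda>x. of_real (deriv \<phi> x) * F x) = (LINT x|lborel. of_real (deriv \<phi> x) * F x)"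
    by (intro integral_lborel integrable_mult_Bc test_fn_of_real_integrable test_fn_deriv \<phi> F)
  then show ?thesis by (simp add: dderiv_fun_def distr_of_def dderiv_def dist_fun_def \<phi>)
qed

lemma clinear_on_dderiv_fun: "clinear_on Bc dderiv_fun"
proof (rule clinear_on_Bc_if_integral_operator)
  let ?w = "\<lambda>\<phi> x. if test_fn \<phi> then - complex_of_real (deriv \<phi> x) else 0"
  show "dderiv_fun F = integral_operator ?w F" if "F \<in> Bc" for F
  proof
    show "dderiv_fun F \<phi> = integral_operator ?w F \<phi>" for \<phi>
      using dderiv_fun_test_fn[OF that, of \<phi>]
      by (cases "test_fn \<phi>") (simp_all add: integral_operator_def dderiv_fun_def distr_of_def)
  qed
  show "integrable lborel (?w \<phi>)" for \<phi>
    using test_fn_of_real_integrable[OF test_fn_deriv] by (cases "test_fn \<phi>") simp_all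
qed

lemma inj_on_dderiv_fun: "inj_on dderiv_fun Bc"
  unfolding inj_on_clinear_iff[OF cspace_Bc clinear_on_dderiv_fun]
proof (intro ballI impI)
  fix F assume F: "F \<in> Bc" "dderiv_fun F = (\<lambda>\<phi>. 0)"
  then have "(LINT t|lborel. deriv \<phi> t * F t) = 0" if "test_fn \<phi>" for \<phi>
    using dderiv_fun_test_fn[OF F(1) that] by simp
  with F(1) show "F = (\<lambda>x. 0)" by (rule Bc_eq_0_if_orthogonal_to_derivatives)
qed

lemma Ac_eq: "Ac = dderiv_fun ` Bc"
  by (auto simp: Ac_def dderiv_fun_def)

lemma prim_dderiv_fun: "F \<in> Bc \<Longrightarrow> prim (dderiv_fun F) = F"
  unfolding prim_def dderiv_fun_def[symmetric]
  by (rule the_equality) (use inj_on_dderiv_fun in \<open>auto dest: inj_onD\<close>)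

lemma alex_dderiv_fun: "F \<in> Bc \<Longrightarrow> alex (dderiv_fun F) = supnorm F"
  by (simp add: alex_def prim_dderiv_fun)

section \<open>The transform \<open>\<Omega>\<close> and its second derivative\<close>

definition vfun_deriv_num :: "real \<Rightarrow> complex" where
  "vfun_deriv_num x = \<i> * x + \<i> * x * cis (- x) - 2 + 2 * cis (- x)"

text \<open>At \<open>t = 0\<close> division by zero gives \<open>0\<close> instead of the derivative \<open>- \<i> s\<^sup>3 / 6\<close> of \<open>vfun s\<close>.\<close>
definition vfun_deriv :: "real \<Rightarrow> real \<Rightarrow> complex" where
  "vfun_deriv s t = vfun_deriv_num (s * t) / of_real t ^ 3"

lemma vfun_has_derivative:
  assumes t: "t \<noteq> 0" shows "(vfun s has_vector_derivative vfun_deriv s t) (at t)"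
proof -
  have inverse_square: "((\<lambda>t. complex_of_real (1 / t\<^sup>2)) has_vector_derivative
      of_real (- 2 / t ^ 3)) (at t)"
    using t by (intro has_vector_derivative_of_real)
      (auto intro!: derivative_eq_intros simp: power2_eq_square power3_eq_cube field_simps)
  have "((\<lambda>t. 1 - \<i> * of_real (s * t) - cis (- (s * t))) has_vector_derivative
      - \<i> * of_real s + \<i> * of_real s * cis (- (s * t))) (at t)"
    by (auto intro!: derivative_eq_intros
        simp: has_vector_derivative_def scaleR_conv_of_real algebra_simps)
  from has_vector_derivative_mult[OF this inverse_square]
  have "((\<lambda>t. (1 - \<i> * of_real (s * t) - cis (- (s * t))) * of_real (1 / t\<^sup>2))
      has_vector_derivative vfun_deriv s t) (at t)"
    by (rule has_vector_derivative_eq_rhs)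
      (use t in \<open>simp add: vfun_deriv_def vfun_deriv_num_def field_simps power2_eq_square
        power3_eq_cube\<close>)
  then show ?thesis
    by (rule has_vector_derivative_transform_within_open[where S = "- {0}"])
      (use t in \<open>auto simp: vfun_def cis_conv_exp\<close>)
qed

lemma vfun_tendsto_0: "(vfun s \<longlongrightarrow> 0) at_top"
proof (rule Lim_null_comparison)
  show "\<forall>\<^sub>F t in at_top. norm (vfun s t) \<le> (2 + \<bar>s\<bar> * t) / t\<^sup>2"
    using eventually_gt_at_top[of 0]
  proof eventually_elim
    case (elim t)
    have "cmod (1 - \<i> * of_real (s * t) - cis (- (s * t)))
        \<le> cmod 1 + cmod (\<i> * of_real (s * t)) + cmod (cis (- (s * t)))"
      by (intro order_trans[OF norm_triangle_ineq4] add_right_mono norm_triangle_ineq4)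
    also have "\<dots> = 2 + \<bar>s\<bar> * t" using elim by (simp add: norm_mult abs_mult)
    finally show ?case using elim
      by (simp add: vfun_def cis_conv_exp norm_divide divide_right_mono norm_power)
  qed
  show "((\<lambda>t. (2 + \<bar>s\<bar> * t) / t\<^sup>2) \<longlongrightarrow> 0) at_top" by real_asymp
qed

lemma norm_vfun_deriv_num_le: "cmod (vfun_deriv_num x) \<le> 4 * \<bar>x\<bar>"
proof -
  have "cmod (vfun_deriv_num x)
      \<le> cmod (\<i> * of_real x * (1 + cis (- x))) + cmod (2 * (cis (- x) - 1))"
    by (rule order_trans[OF eq_refl norm_triangle_ineq])
      (simp add: vfun_deriv_num_def algebra_simps)
  also have "\<dots> = \<bar>x\<bar> * cmod (1 + cis (- x)) + 2 * cmod (cis (- x) - 1)"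
    unfolding norm_mult by simp
  also have "\<dots> \<le> \<bar>x\<bar> * 2 + 2 * \<bar>x\<bar>"
    using norm_triangle_ineq[of 1 "cis (- x)"] norm_cis_diff_1_le[of "- x"]
    by (intro add_mono mult_left_mono) simp_all
  finally show ?thesis by simp
qed

lemma norm_vfun_deriv_num_le_cube: "cmod (vfun_deriv_num x) \<le> \<bar>x\<bar> ^ 3"
proof -
  define R\<^sub>1 R\<^sub>2 where "R\<^sub>1 = cis (- x) - (1 - \<i> * x)" and "R\<^sub>2 = cis (- x) - (1 - \<i> * x - x\<^sup>2 / 2)"
  have R\<^sub>1: "cmod R\<^sub>1 \<le> \<bar>x\<bar>\<^sup>2 / 2"
    using iexp_approx1[of "- x" 1] by (simp add: R\<^sub>1_def cis_conv_exp numeral_2_eq_2)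
  have "(\<Sum>k\<le>2. (\<i> * complex_of_real (- x)) ^ k / fact k) = 1 - \<i> * x - x\<^sup>2 / 2"
    by (simp add: numeral_2_eq_2 complex_eq_iff)
  then have R\<^sub>2: "cmod R\<^sub>2 \<le> \<bar>x\<bar> ^ 3 / 6"
    using iexp_approx1[of "- x" 2] by (simp add: R\<^sub>2_def cis_conv_exp fact_numeral)
  have "cmod (vfun_deriv_num x) \<le> cmod (\<i> * of_real x * R\<^sub>1) + cmod (2 * R\<^sub>2)"
    by (rule order_trans[OF eq_refl norm_triangle_ineq])
      (simp add: vfun_deriv_num_def R\<^sub>1_def R\<^sub>2_def algebra_simps power2_eq_square)
  also have "\<dots> = \<bar>x\<bar> * cmod R\<^sub>1 + 2 * cmod R\<^sub>2" by (simp add: norm_mult)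
  also have "\<dots> \<le> \<bar>x\<bar> * (\<bar>x\<bar>\<^sup>2 / 2) + 2 * (\<bar>x\<bar> ^ 3 / 6)"
    using R\<^sub>1 R\<^sub>2 by (intro add_mono mult_left_mono) simp_all
  also have "\<dots> = 5 / 6 * \<bar>x\<bar> ^ 3" by (simp add: power2_eq_square power3_eq_cube)
  also have "\<dots> \<le> \<bar>x\<bar> ^ 3" by simp
  finally show ?thesis .
qed

lemma vfun_deriv_decay: "(1 + t\<^sup>2) * cmod (vfun_deriv s t) \<le> \<bar>s\<bar> ^ 3 + 4 * \<bar>s\<bar>"
proof (cases "t = 0")
  case False
  have norm_eq: "cmod (vfun_deriv s t) = cmod (vfun_deriv_num (s * t)) / \<bar>t\<bar> ^ 3"
    by (simp add: vfun_deriv_def norm_divide norm_power)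
  have "cmod (vfun_deriv s t) \<le> \<bar>s\<bar> ^ 3"
    using norm_vfun_deriv_num_le_cube[of "s * t"] False
    by (simp add: norm_eq abs_mult power_mult_distrib pos_divide_le_eq)
  moreover have "t\<^sup>2 * cmod (vfun_deriv s t) = cmod (vfun_deriv_num (s * t)) / \<bar>t\<bar>"
    unfolding norm_eq power2_abs[of t, symmetric] using False
    by (simp add: power2_eq_square power3_eq_cube)
  moreover have "\<dots> \<le> 4 * \<bar>s\<bar>"
    using norm_vfun_deriv_num_le[of "s * t"] False
    by (simp add: abs_mult pos_divide_le_eq mult.assoc)
  ultimately show ?thesis by (simp add: distrib_right)
qed (simp add: vfun_deriv_def)

lemma vfun_deriv_num_measurable [measurable]: "vfun_deriv_num \<in> borel_measurable borel"
  unfolding vfun_deriv_num_def by measurable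

lemma vfun_deriv_integrable: "integrable lborel (vfun_deriv s)"
  by (rule integrable_if_inverse_square_decay[OF _ vfun_deriv_decay]) (simp add: vfun_deriv_def)

lemma Omega_dderiv_fun:
  assumes F: "F \<in> Bc"
  shows "Omega (dderiv_fun F) = integral_operator (\<lambda>s t. - vfun_deriv s t) F"
proof
  fix s
  have "Lim at_top (vfun s) = 0" by (rule tendsto_Lim[OF _ vfun_tendsto_0]) simp
  moreover have "integral UNIV (\<lambda>t. F t * vector_derivative (vfun s) (at t))
      = integral UNIV (\<lambda>t. vfun_deriv s t * F t)"
    by (rule integral_spike[of "{0}"]) (auto simp: vector_derivative_at[OF vfun_has_derivative])
  moreover have "\<dots> = (LINT t|lborel. vfun_deriv s t * F t)"
    by (rule integral_lborel[OF integrable_mult_Bc[OF vfun_deriv_integrable F]])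
  ultimately show "Omega (dderiv_fun F) s = integral_operator (\<lambda>s t. - vfun_deriv s t) F s"
    by (simp add: Omega_def pairing_def prim_dderiv_fun[OF F] integral_operator_def)
qed

lemma LINT_deriv2_mult_vfun_deriv:
  assumes \<phi>: "test_fn \<phi>" and t: "t \<noteq> 0"
  shows "(LINT s|lborel. deriv (deriv \<phi>) s * vfun_deriv s t) = fourier_derivative_real \<phi> t"
proof -
  let ?v' = "\<lambda>s. (\<i> - \<i> * cis (- (s * t)) + of_real (s * t) * cis (- (s * t))) / of_real t ^ 2"
  let ?v'' = "\<lambda>s. - \<i> * of_real s * cis (- (s * t))"
  have v': "((\<lambda>s. vfun_deriv s t) has_vector_derivative ?v' s) (at s)" for s
    unfolding vfun_deriv_def vfun_deriv_num_def using t
    by (auto intro!: derivative_eq_intros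
        simp: has_vector_derivative_def scaleR_conv_of_real field_simps power2_eq_square
          power3_eq_cube)
  have v'': "(?v' has_vector_derivative ?v'' s) (at s)" for s
    using t
    by (auto intro!: derivative_eq_intros
        simp: has_vector_derivative_def scaleR_conv_of_real field_simps power2_eq_square)
  have "(LINT s|lborel. deriv (deriv \<phi>) s * vfun_deriv s t) = - (LINT s|lborel. deriv \<phi> s * ?v' s)"
    by (rule test_fn_integration_by_parts[OF test_fn_deriv[OF \<phi>] v'])
      (use t in \<open>auto intro!: continuous_intros\<close>)
  also have "(LINT s|lborel. deriv \<phi> s * ?v' s) = - (LINT s|lborel. \<phi> s * ?v'' s)"
    by (rule test_fn_integration_by_parts[OF \<phi> v'']) (auto intro!: continuous_intros)
  finally show ?thesis by (simp add: fourier_derivative_def fourier_def mult_ac)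
qed

lemma integrable_test_fn_mult_vfun_deriv:
  assumes \<phi>: "test_fn \<phi>" and F: "F \<in> Bc"
  shows "integrable (lborel \<Otimes>\<^sub>M lborel) (\<lambda>(s, t). of_real (\<phi> s) * (vfun_deriv s t * F t))"
proof (rule integrable_pair_dominated)
  note [measurable] = Bc_measurable[OF F] borel_measurable_integrable[OF test_fn_integrable[OF \<phi>]]
  show "(\<lambda>(s, t). of_real (\<phi> s) * (vfun_deriv s t * F t)) \<in> borel_measurable (lborel \<Otimes>\<^sub>M lborel)"
    unfolding vfun_deriv_def by measurable
  have "integrable lborel (\<lambda>s. complex_of_real (\<phi> s) * of_real (\<bar>s\<bar> ^ 3 + 4 * \<bar>s\<bar>))"
    by (intro test_fn_mult_integrable \<phi> continuous_intros)
  from integrable_norm[OF this] show "integrable lborel (\<lambda>s. \<bar>\<phi> s\<bar> * (\<bar>s\<bar> ^ 3 + 4 * \<bar>s\<bar>))"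
    by (simp add: norm_mult del: of_real_add)
  show "integrable lborel (\<lambda>t. inverse (1 + t\<^sup>2) * supnorm F)"
    by (intro integrable_mult_left integrable_inverse_one_plus_square)
  fix s t
  have "cmod (vfun_deriv s t) \<le> (\<bar>s\<bar> ^ 3 + 4 * \<bar>s\<bar>) * inverse (1 + t\<^sup>2)"
    using vfun_deriv_decay[of t s] add_pos_nonneg[OF zero_less_one zero_le_power2[of t]]
    by (simp add: field_simps)
  then have "cmod (vfun_deriv s t) * cmod (F t)
      \<le> (\<bar>s\<bar> ^ 3 + 4 * \<bar>s\<bar>) * inverse (1 + t\<^sup>2) * supnorm F"
    by (intro mult_mono cmod_le_supnorm Bc_bounded[OF F]) auto
  from mult_left_mono[OF this, of "\<bar>\<phi> s\<bar>"]
  show "cmod (of_real (\<phi> s) * (vfun_deriv s t * F t))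
      \<le> \<bar>\<phi> s\<bar> * (\<bar>s\<bar> ^ 3 + 4 * \<bar>s\<bar>) * (inverse (1 + t\<^sup>2) * supnorm F)"
    by (simp add: norm_mult mult.assoc)
qed

lemma Omega2_dderiv_fun_test_fn:
  assumes F: "F \<in> Bc" and \<phi>: "test_fn \<phi>"
  shows "Omega2 (dderiv_fun F) \<phi> = - (LINT t|lborel. fourier_derivative_real \<phi> t * F t)"
proof -
  let ?\<phi>'' = "deriv (deriv \<phi>)"
  let ?f = "\<lambda>s t. complex_of_real (?\<phi>'' s) * (vfun_deriv s t * F t)"
  have integrable: "integrable (lborel \<Otimes>\<^sub>M lborel) (case_prod ?f)"
    by (intro integrable_test_fn_mult_vfun_deriv test_fn_deriv \<phi> F)
  have Omega: "of_real (?\<phi>'' s) * Omega (dderiv_fun F) s = - (LINT t|lborel. ?f s t)" for s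
    by (simp add: Omega_dderiv_fun[OF F] integral_operator_def)
  have "Omega2 (dderiv_fun F) \<phi> = integral UNIV (\<lambda>s. - (LINT t|lborel. ?f s t))"
    by (simp only: Omega2_def distr_of_def dderiv_def dist_fun_def \<phi> if_True minus_minus Omega)
  also have "\<dots> = - (LINT s|lborel. LINT t|lborel. ?f s t)"
    using lborel_pair.integrable_fst[OF integrable] by (subst integral_lborel) simp_all
  also have "(LINT s|lborel. LINT t|lborel. ?f s t) = (LINT t|lborel. LINT s|lborel. ?f s t)"
    by (rule lborel_pair.Fubini_integral[OF integrable, symmetric])
  also have "\<dots> = (LINT t|lborel. fourier_derivative_real \<phi> t * F t)"
  proof (rule integral_cong_AE)
    have "(LINT s|lborel. ?f s t) = fourier_derivative_real \<phi> t * F t" if "t \<noteq> 0" for t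
      by (simp only: mult.assoc[symmetric] integral_mult_left_zero
          LINT_deriv2_mult_vfun_deriv[OF \<phi> that])
    then show "AE t in lborel. (LINT s|lborel. ?f s t) = fourier_derivative_real \<phi> t * F t"
      using AE_lborel_singleton[of 0] by (auto elim!: eventually_mono)
    show "(\<lambda>t. LINT s|lborel. ?f s t) \<in> borel_measurable lborel"
      using borel_measurable_integrable[OF lborel_pair.integrable_snd[OF integrable]] by simp
    show "(\<lambda>t. fourier_derivative_real \<phi> t * F t) \<in> borel_measurable lborel"
      using integrable_C1_kernel.measurable(2)[OF integrable_C1_kernel_fourier[OF \<phi>]]
        Bc_measurable[OF F] by simp
  qed
  finally show ?thesis .
qed

lemma clinear_on_Omega: "clinear_on Bc (\<lambda>F. Omega (dderiv_fun F))"
  by (rule clinear_on_Bc_if_integral_operator[OF Omega_dderiv_fun])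
    (simp_all add: vfun_deriv_integrable)

lemma clinear_on_Omega2: "clinear_on Bc (\<lambda>F. Omega2 (dderiv_fun F))"
proof (rule clinear_on_Bc_if_integral_operator)
  let ?w = "\<lambda>\<phi> t. if test_fn \<phi> then - fourier_derivative_real \<phi> t else 0"
  show "Omega2 (dderiv_fun F) = integral_operator ?w F" if "F \<in> Bc" for F
  proof
    show "Omega2 (dderiv_fun F) \<phi> = integral_operator ?w F \<phi>" for \<phi>
      using Omega2_dderiv_fun_test_fn[OF that, of \<phi>]
      by (cases "test_fn \<phi>") (simp_all add: integral_operator_def Omega2_def distr_of_def)
  qed
  show "integrable lborel (?w \<phi>)" for \<phi>
    using integrable_C1_kernel.integrable_derivative[OF integrable_C1_kernel_fourier]
    by (cases "test_fn \<phi>") simp_all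
qed

lemma inj_on_Omega2: "inj_on (\<lambda>F. Omega2 (dderiv_fun F)) Bc"
  unfolding inj_on_clinear_iff[OF cspace_Bc clinear_on_Omega2]
proof (intro ballI impI)
  fix F assume F: "F \<in> Bc" "Omega2 (dderiv_fun F) = (\<lambda>\<phi>. 0)"
  then have "(LINT t|lborel. fourier_derivative_real \<phi> t * F t) = 0" if "test_fn \<phi>" for \<phi>
    using Omega2_dderiv_fun_test_fn[OF F(1) that] by simp
  with F(1) show "F = (\<lambda>x. 0)" by (rule Bc_eq_0_if_orthogonal_to_fourier_derivatives)
qed

lemma inj_on_Omega: "inj_on (\<lambda>F. Omega (dderiv_fun F)) Bc"
  using inj_on_Omega2 by (auto simp: inj_on_def Omega2_def)

lemma norm1_Omega:
  assumes F: "F \<in> Bc" shows "norm1 (Omega (dderiv_fun F)) = supnorm F"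
proof -
  have "inj_on Omega Ac"
    unfolding Ac_eq using inj_on_Omega by (intro inj_on_imageI) (simp add: comp_def)
  from the_inv_into_f_f[OF this, of "dderiv_fun F"] show ?thesis
    using F by (simp add: norm1_def the_inv_into_def alex_dderiv_fun Ac_eq)
qed

lemma norm2_Omega2:
  assumes F: "F \<in> Bc" shows "norm2 (Omega2 (dderiv_fun F)) = supnorm F"
proof -
  have "inj_on Omega2 Ac"
    unfolding Ac_eq using inj_on_Omega2 by (intro inj_on_imageI) (simp add: comp_def)
  from the_inv_into_f_f[OF this, of "dderiv_fun F"] show ?thesis
    using F by (simp add: norm2_def the_inv_into_def alex_dderiv_fun Ac_eq)
qed

lemma isometric_iso_Bc_Ac: "isometric_iso Bc supnorm Ac alex"
  unfolding Ac_eq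
  by (rule isometric_iso_image)
    (simp_all add: clinear_on_dderiv_fun inj_on_dderiv_fun alex_dderiv_fun)

lemma isometric_iso_Bc_Cc: "isometric_iso Bc supnorm Cc norm1"
  unfolding Cc_def Ac_eq image_image
  by (rule isometric_iso_image) (simp_all add: clinear_on_Omega inj_on_Omega norm1_Omega)

lemma isometric_iso_Bc_Dc: "isometric_iso Bc supnorm Dc norm2"
  unfolding Dc_def Ac_eq image_image
  by (rule isometric_iso_image) (simp_all add: clinear_on_Omega2 inj_on_Omega2 norm2_Omega2)

theorem mainTheorem2:
  shows "(banach_on Cc norm1 \<and> isometric_iso Ac alex Cc norm1)
    \<and> (banach_on Dc norm2 \<and> isometric_iso Ac alex Dc norm2)
    \<and> (banach_on Ac alex \<and> banach_on Bc supnorm \<and> banach_on Cc norm1 \<and> banach_on Dc norm2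
       \<and> isometric_iso Ac alex Bc supnorm \<and> isometric_iso Ac alex Cc norm1
       \<and> isometric_iso Ac alex Dc norm2 \<and> isometric_iso Bc supnorm Cc norm1
       \<and> isometric_iso Bc supnorm Dc norm2 \<and> isometric_iso Cc norm1 Dc norm2)"
proof -
  note from_Bc = isometric_iso_Bc_Ac isometric_iso_Bc_Cc isometric_iso_Bc_Dc
  note to_Bc = from_Bc[THEN isometric_iso_sym[OF cspace_Bc]]
  have "isometric_iso Ac alex Cc norm1" "isometric_iso Ac alex Dc norm2"
    "isometric_iso Cc norm1 Dc norm2"
    using to_Bc(1,2) from_Bc(2,3) by (blast intro: isometric_iso_trans)+
  moreover have "banach_on Ac alex" "banach_on Cc norm1" "banach_on Dc norm2"
    using from_Bc by (blast intro: banach_on_isometric_iso[OF banach_on_Bc])+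
  ultimately show ?thesis using banach_on_Bc from_Bc to_Bc by blast
qed

end
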